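(* Let $k$ be a field, let $p$ be a prime number, let $s \in \mathbb{Z}_p \setminus \{0\}$, let $q \in k$ be a primitive $p$-th root of unity, and let $H$ be the Hopf algebra over $k$ with generators $g, x, y$ and defining algebra and coalgebra relations $$ gx = q\,xg,\quad gy = q^{-s}\,yg,\quad g^p = 1,\quad x^p = y^p = 0,\quad xy = q^{-s}\,yx, $$ $$ \Delta(g) = g \otimes g,\quad \Delta(x) = 1 \otimes x + x \otimes g,\quad \Delta(y) = 1 \otimes y + y \otimes g^s. $$ Then the antipode $S$ of $H$ is determined by $$ S(g) = g^{-1},\quad S(x) = -xg^{-1},\quad S(y) = -yg^{-s}, $$ and $H$ has a modular pair in involution if and only if $s \in \{0, 1, p-1\}$ (as elements of $\mathbb{Z}_p$).
   Context: Here $\mathbb{Z}_p = \mathbb{Z}/p\mathbb{Z}$; the expressions $g^s$ and $q^{s}$ for $s \in \mathbb{Z}_p$ are well defined since $g^p = 1$ and $q^p = 1$. $H$ is the associative unital $k$-algebra presented by the generators $g,x,y$ and the listed algebra relations, with $\Delta$ the algebra homomorphism $H \to H \otimes H$ given on generators as stated; the counit $\varepsilon$ is then given by $\varepsilon(g) = 1$, $\varepsilon(x) = \varepsilon(y) = 0$. Modular pair in involution: Let $H$ be a Hopf algebra over $k$ with antipode $S$, and let $H^\circ$ be its Hopf dual. A group-like element $\beta \in H^\circ$ is the same thing as a character of $H$, i.e. a unital $k$-algebra homomorphism $\beta \colon H \to k$; its convolution inverse is $\beta^{-1} = \beta \circ S$. A pair $(l, \beta)$ of group-like elements $l \in H$,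 $\beta \in H^\circ$ is a modular pair in involution if $\beta(l) = 1$ and $$ S^2(h) = \beta(h_{(1)})\, l\, h_{(2)}\, l^{-1}\, \beta^{-1}(h_{(3)}) $$ for all $h \in H$, where $h_{(1)} \otimes h_{(2)} \otimes h_{(3)} = (\Delta \otimes \mathrm{id})\Delta(h)$ is Sweedler notation (summation understood). *)

theory Defs
  imports Complex_Main "HOL-Library.Poly_Mapping" "HOL-Computational_Algebra.Primes"
begin

section \<open>Free vector spaces\<close>

text \<open>
  The type \<open>'a \<Rightarrow>\<^sub>0 'k\<close> of finitely supported functions is the free vector space over the
  field \<open>'k\<close> with basis \<open>'a\<close>.
\<close>

definition fscale :: "'k::field \<Rightarrow> ('a \<Rightarrow>\<^sub>0 'k) \<Rightarrow> ('a \<Rightarrow>\<^sub>0 'k)" where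
  "fscale c u = Poly_Mapping.map ((*) c) u"

abbreviation pure :: "'a \<Rightarrow> ('a \<Rightarrow>\<^sub>0 'k::field)" where
  "pure a \<equiv> Poly_Mapping.single a 1"

text \<open>The linear extension of \<open>f\<close>, given on the basis, into a space with scaling \<open>sc\<close>.\<close>

definition lin_ext :: "('k::field \<Rightarrow> 'b \<Rightarrow> 'b) \<Rightarrow> ('a \<Rightarrow> 'b::ab_group_add) \<Rightarrow> ('a \<Rightarrow>\<^sub>0 'k) \<Rightarrow> 'b" where
  "lin_ext sc f u = (\<Sum>a\<in>Poly_Mapping.keys u. sc (Poly_Mapping.lookup u a) (f a))"

lemma lookup_fscale: "Poly_Mapping.lookup (fscale c u) a = c * Poly_Mapping.lookup u a"
  by (simp add: fscale_def Poly_Mapping.map.rep_eq when_def)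

lemma vector_space_fscale: "vector_space (fscale :: 'k::field \<Rightarrow> ('a \<Rightarrow>\<^sub>0 'k) \<Rightarrow> ('a \<Rightarrow>\<^sub>0 'k))"
  by unfold_locales (auto intro!: poly_mapping_eqI simp: lookup_fscale lookup_add algebra_simps)


section \<open>Algebras over a field, and presentations\<close>

locale k_algebra = vector_space scale
  for scale :: "'k::field \<Rightarrow> 'a::ring_1 \<Rightarrow> 'a" +
  assumes scale_mult_left: "scale c a * b = scale c (a * b)"
    and scale_mult_right: "a * scale c b = scale c (a * b)"

definition algebra_antihom :: "('k::field \<Rightarrow> 'a::ring_1 \<Rightarrow> 'a) \<Rightarrow> ('a \<Rightarrow> 'a) \<Rightarrow> bool" where
  "algebra_antihom scale T \<longleftrightarrow> Vector_Spaces.linear scale scale T \<and> T 1 = 1 \<and>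
     (\<forall>a b. T (a * b) = T b * T a)"

definition algebra_character :: "('k::field \<Rightarrow> 'a::ring_1 \<Rightarrow> 'a) \<Rightarrow> ('a \<Rightarrow> 'k) \<Rightarrow> bool" where
  "algebra_character scale \<beta> \<longleftrightarrow> Vector_Spaces.linear scale (*) \<beta> \<and> \<beta> 1 = 1 \<and>
     (\<forall>a b. \<beta> (a * b) = \<beta> a * \<beta> b)"

text \<open>The inverse of a unit; unspecified on non-units.\<close>

definition unit_inv :: "'a::ring_1 \<Rightarrow> 'a" where
  "unit_inv u = (THE v. u * v = 1 \<and> v * u = 1)"

text \<open>
  The free monoid is written additively, so that \<open>'a free_monoid \<Rightarrow>\<^sub>0 'k\<close> with the convolution
  product of the library is the free unital associative algebra on \<open>'a\<close>.
\<close>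

datatype 'a free_monoid = Word (letters: "'a list")

instantiation free_monoid :: (type) monoid_add
begin

definition zero_free_monoid :: "'a free_monoid" where
  "0 = Word []"

definition plus_free_monoid :: "'a free_monoid \<Rightarrow> 'a free_monoid \<Rightarrow> 'a free_monoid" where
  "v + w = Word (letters v @ letters w)"

instance
  by standard (auto simp: zero_free_monoid_def plus_free_monoid_def)

end

type_synonym ('a, 'k) free_algebra = "'a free_monoid \<Rightarrow>\<^sub>0 'k"

definition free_gen :: "'a \<Rightarrow> ('a, 'k::field) free_algebra" where
  "free_gen a = pure (Word [a])"

definition free_const :: "'k::field \<Rightarrow> ('a, 'k) free_algebra" where
  "free_const c = Poly_Mapping.single 0 c"

definition free_eval ::
  "('k::field \<Rightarrow> 'h \<Rightarrow> 'h) \<Rightarrow> ('a \<Rightarrow> 'h::ring_1) \<Rightarrow> ('a, 'k) free_algebra \<Rightarrow> 'h" where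
  "free_eval scale f = lin_ext scale (\<lambda>w. prod_list (map f (letters w)))"

definition two_sided_ideal :: "'a::ring_1 set \<Rightarrow> bool" where
  "two_sided_ideal I \<longleftrightarrow> 0 \<in> I \<and> (\<forall>a\<in>I. \<forall>b\<in>I. a + b \<in> I) \<and> (\<forall>r. \<forall>a\<in>I. r * a \<in> I \<and> a * r \<in> I)"

definition ideal_generated :: "'a::ring_1 set \<Rightarrow> 'a set" where
  "ideal_generated R = \<Inter>{I. two_sided_ideal I \<and> R \<subseteq> I}"

text \<open>
  The algebra \<open>'h\<close> is the quotient of the free algebra on \<open>'a\<close> by the two-sided ideal generated
  by \<open>R\<close>, the class of the generator \<open>a\<close> being \<open>f a\<close>.
\<close>

definition presented_by ::
  "('k::field \<Rightarrow> 'h \<Rightarrow> 'h) \<Rightarrow> ('a \<Rightarrow> 'h::ring_1) \<Rightarrow> ('a, 'k) free_algebra set \<Rightarrow> bool" where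
  "presented_by scale f R \<longleftrightarrow>
     surj (free_eval scale f) \<and> {u. free_eval scale f u = 0} = ideal_generated R"


section \<open>Tensor products\<close>

text \<open>
  The tensor square (cube) of a space is the free vector space on pairs (triples) modulo the span of
  the multilinearity relations.  Tensors are represented by formal sums of pairs (triples), and
  equality of tensors is the congruence \<open>tensor_eq2\<close> (\<open>tensor_eq3\<close>).
\<close>

definition tensor_rels2 ::
  "('k::field \<Rightarrow> 'a::ab_group_add \<Rightarrow> 'a) \<Rightarrow> ('a \<times> 'a \<Rightarrow>\<^sub>0 'k) set" where
  "tensor_rels2 scale =
     {pure (a + a', b) - pure (a, b) - pure (a', b) | a a' b. True} \<union>
     {pure (a, b + b') - pure (a, b) - pure (a, b') | a b b'. True} \<union>
     {pure (scale c a, b) - fscale c (pure (a, b)) | c a b. True} \<union>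
     {pure (a, scale c b) - fscale c (pure (a, b)) | c a b. True}"

definition tensor_eq2 ::
  "('k::field \<Rightarrow> 'a::ab_group_add \<Rightarrow> 'a) \<Rightarrow> ('a \<times> 'a \<Rightarrow>\<^sub>0 'k) \<Rightarrow> ('a \<times> 'a \<Rightarrow>\<^sub>0 'k) \<Rightarrow> bool" where
  "tensor_eq2 scale u v \<longleftrightarrow> u - v \<in> module.span fscale (tensor_rels2 scale)"

definition tensor_rels3 ::
  "('k::field \<Rightarrow> 'a::ab_group_add \<Rightarrow> 'a) \<Rightarrow> ('a \<times> 'a \<times> 'a \<Rightarrow>\<^sub>0 'k) set" where
  "tensor_rels3 scale =
     {pure (a + a', b, d) - pure (a, b, d) - pure (a', b, d) | a a' b d. True} \<union>
     {pure (a, b + b', d) - pure (a, b, d) - pure (a, b', d) | a b b' d. True} \<union>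
     {pure (a, b, d + d') - pure (a, b, d) - pure (a, b, d') | a b d d'. True} \<union>
     {pure (scale c a, b, d) - fscale c (pure (a, b, d)) | c a b d. True} \<union>
     {pure (a, scale c b, d) - fscale c (pure (a, b, d)) | c a b d. True} \<union>
     {pure (a, b, scale c d) - fscale c (pure (a, b, d)) | c a b d. True}"

definition tensor_eq3 ::
  "('k::field \<Rightarrow> 'a::ab_group_add \<Rightarrow> 'a) \<Rightarrow> ('a \<times> 'a \<times> 'a \<Rightarrow>\<^sub>0 'k) \<Rightarrow> ('a \<times> 'a \<times> 'a \<Rightarrow>\<^sub>0 'k) \<Rightarrow> bool" where
  "tensor_eq3 scale u v \<longleftrightarrow> u - v \<in> module.span fscale (tensor_rels3 scale)"

text \<open>The product \<open>(a \<otimes> b) (c \<otimes> d) = a c \<otimes> b d\<close>, extended bilinearly.\<close>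

definition tensor_mult ::
  "('a::ring_1 \<times> 'a \<Rightarrow>\<^sub>0 'k::field) \<Rightarrow> ('a \<times> 'a \<Rightarrow>\<^sub>0 'k) \<Rightarrow> ('a \<times> 'a \<Rightarrow>\<^sub>0 'k)" where
  "tensor_mult u v =
     lin_ext fscale (\<lambda>(a, b). lin_ext fscale (\<lambda>(c, d). pure (a * c, b * d)) v) u"


section \<open>Hopf algebras\<close>

text \<open>\<open>(\<Delta> \<otimes> id) \<circ> \<Delta>\<close> and \<open>(id \<otimes> \<Delta>) \<circ> \<Delta>\<close>.\<close>

definition comult_left ::
  "('a \<Rightarrow> ('a \<times> 'a \<Rightarrow>\<^sub>0 'k::field)) \<Rightarrow> 'a \<Rightarrow> ('a \<times> 'a \<times> 'a \<Rightarrow>\<^sub>0 'k)" where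
  "comult_left \<Delta> h =
     lin_ext fscale (\<lambda>(a, b). lin_ext fscale (\<lambda>(a1, a2). pure (a1, a2, b)) (\<Delta> a)) (\<Delta> h)"

definition comult_right ::
  "('a \<Rightarrow> ('a \<times> 'a \<Rightarrow>\<^sub>0 'k::field)) \<Rightarrow> 'a \<Rightarrow> ('a \<times> 'a \<times> 'a \<Rightarrow>\<^sub>0 'k)" where
  "comult_right \<Delta> h =
     lin_ext fscale (\<lambda>(a, b). lin_ext fscale (\<lambda>(b1, b2). pure (a, b1, b2)) (\<Delta> b)) (\<Delta> h)"

text \<open>
  The value \<open>\<Delta> h\<close> is a formal sum representing the coproduct of \<open>h\<close> in the tensor square; the
  axioms only concern the tensor it represents.
\<close>

locale bialgebra = k_algebra scale
  for scale :: "'k::field \<Rightarrow> 'a::ring_1 \<Rightarrow> 'a" +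
  fixes \<Delta> :: "'a \<Rightarrow> ('a \<times> 'a \<Rightarrow>\<^sub>0 'k)" and \<epsilon> :: "'a \<Rightarrow> 'k"
  assumes comult_add: "tensor_eq2 scale (\<Delta> (a + b)) (\<Delta> a + \<Delta> b)"
    and comult_scale: "tensor_eq2 scale (\<Delta> (scale c a)) (fscale c (\<Delta> a))"
    and comult_one: "tensor_eq2 scale (\<Delta> 1) (pure (1, 1))"
    and comult_mult: "tensor_eq2 scale (\<Delta> (a * b)) (tensor_mult (\<Delta> a) (\<Delta> b))"
    and counit_character: "algebra_character scale \<epsilon>"
    and coassoc: "tensor_eq3 scale (comult_left \<Delta> h) (comult_right \<Delta> h)"
    and counit_left: "lin_ext scale (\<lambda>(a, b). scale (\<epsilon> a) b) (\<Delta> h) = h"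
    and counit_right: "lin_ext scale (\<lambda>(a, b). scale (\<epsilon> b) a) (\<Delta> h) = h"

locale hopf_algebra = bialgebra scale \<Delta> \<epsilon>
  for scale :: "'k::field \<Rightarrow> 'a::ring_1 \<Rightarrow> 'a"
    and \<Delta> :: "'a \<Rightarrow> ('a \<times> 'a \<Rightarrow>\<^sub>0 'k)" and \<epsilon> :: "'a \<Rightarrow> 'k" +
  fixes S :: "'a \<Rightarrow> 'a"
  assumes antipode_linear: "Vector_Spaces.linear scale scale S"
    and antipode_left: "lin_ext scale (\<lambda>(a, b). S a * b) (\<Delta> h) = scale (\<epsilon> h) 1"
    and antipode_right: "lin_ext scale (\<lambda>(a, b). a * S b) (\<Delta> h) = scale (\<epsilon> h) 1"

definition group_like ::
  "('k::field \<Rightarrow> 'a::ring_1 \<Rightarrow> 'a) \<Rightarrow> ('a \<Rightarrow> ('a \<times> 'a \<Rightarrow>\<^sub>0 'k)) \<Rightarrow> ('a \<Rightarrow> 'k) \<Rightarrow> 'a \<Rightarrow> bool" where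
  "group_like scale \<Delta> \<epsilon> l \<longleftrightarrow> tensor_eq2 scale (\<Delta> l) (pure (l, l)) \<and> \<epsilon> l = 1"

text \<open>
  The group-like elements of the Hopf dual are the characters, and the convolution inverse of
  \<open>\<beta>\<close> is \<open>\<beta> \<circ> S\<close>.
\<close>

definition modular_pair_in_involution ::
  "('k::field \<Rightarrow> 'a::ring_1 \<Rightarrow> 'a) \<Rightarrow> ('a \<Rightarrow> ('a \<times> 'a \<Rightarrow>\<^sub>0 'k)) \<Rightarrow> ('a \<Rightarrow> 'k) \<Rightarrow> ('a \<Rightarrow> 'a) \<Rightarrow>
    'a \<Rightarrow> ('a \<Rightarrow> 'k) \<Rightarrow> bool" where
  "modular_pair_in_involution scale \<Delta> \<epsilon> S l \<beta> \<longleftrightarrow>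
     group_like scale \<Delta> \<epsilon> l \<and> algebra_character scale \<beta> \<and> \<beta> l = 1 \<and>
     (\<forall>h. S (S h) =
        lin_ext scale (\<lambda>(h1, h2, h3). scale (\<beta> h1 * (\<beta> \<circ> S) h3) (l * h2 * unit_inv l))
          (comult_left \<Delta> h))"


section \<open>The defining relations\<close>

definition primitive_root_of_unity :: "nat \<Rightarrow> 'k::field \<Rightarrow> bool" where
  "primitive_root_of_unity n q \<longleftrightarrow> 0 < n \<and> q ^ n = 1 \<and> (\<forall>m. 0 < m \<and> m < n \<longrightarrow> q ^ m \<noteq> 1)"

datatype generator = Gen_g | Gen_x | Gen_y

text \<open>A relation \<open>u = v\<close> is encoded by the element \<open>u - v\<close> of the free algebra.\<close>

definition hopf_relations :: "nat \<Rightarrow> nat \<Rightarrow> 'k::field \<Rightarrow> (generator, 'k) free_algebra set" where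
  "hopf_relations p s q =
     (let G = free_gen Gen_g; X = free_gen Gen_x; Y = free_gen Gen_y in
       {G * X - free_const q * (X * G),
        G * Y - free_const (inverse q ^ s) * (Y * G),
        G ^ p - 1,
        X ^ p,
        Y ^ p,
        X * Y - free_const (inverse q ^ s) * (Y * X)})"

end

theory Submission
  imports Defs "HOL-Computational_Algebra.Polynomial"
begin

text \<open>
  Every character of \<open>H\<close> is some \<open>\<chi>\<^sub>c\<close> with \<open>c\<^sup>p = 1\<close>, sending \<open>g\<close> to \<open>c\<close> and \<open>x, y\<close> to \<open>0\<close>, and for a
  group-like \<open>l\<close> the map \<open>c \<mapsto> \<chi>\<^sub>c(l)\<close> is multiplicative.  If \<open>(l, \<chi>\<^sub>\<zeta>)\<close> is a modular pair in
  involution with \<open>\<zeta> = q\<^sup>j\<close>, the condition on \<open>S\<^sup>2\<close> at \<open>x\<close> and \<open>y\<close> reads \<open>l x = q \<zeta> x l\<close> and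
  \<open>l y = q\<^bsup>-s s\<^esup> \<zeta>\<^sup>s y l\<close>.  Two-dimensional representations in which \<open>x\<close> (or \<open>y\<close>) is nonzero turn
  this into \<open>\<chi>\<^sub>q(l) = q \<zeta>\<close> and a similar value at \<open>q\<^bsup>-s\<^esup>\<close>, so multiplicativity gives
  \<open>s = 2 j + 1\<close> modulo \<open>p\<close>, while \<open>\<chi>\<^sub>\<zeta>(l) = 1\<close> gives \<open>j (j + 1) = 0\<close>.  Conversely \<open>(g, \<epsilon>)\<close> works for
  \<open>s = 1\<close> and \<open>(1, \<chi>\<^sub>c)\<close> with \<open>c = q\<^sup>-\<^sup>1\<close> works for \<open>s = p - 1\<close>.
\<close>

section \<open>Linear extensions and tensors\<close>

text \<open>Enlarging the index set to any finite set containing the support lets the expansions of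
  \<open>u\<close>, \<open>v\<close> and \<open>u + v\<close> be compared term by term.\<close>

lemma lin_ext_superset:
  assumes "vector_space sc" "finite A" "Poly_Mapping.keys u \<subseteq> A"
  shows "lin_ext sc f u = (\<Sum>a\<in>A. sc (Poly_Mapping.lookup u a) (f a))"
proof -
  interpret vector_space sc by fact
  show ?thesis
    unfolding lin_ext_def
    by (rule sum.mono_neutral_left) (use assms in \<open>auto simp: in_keys_iff\<close>)
qed

lemma linear_lin_ext:
  assumes "vector_space sc"
  shows "Vector_Spaces.linear fscale sc (lin_ext sc f)"
proof -
  interpret vector_space sc by fact
  have "lin_ext sc f (u + v) = lin_ext sc f u + lin_ext sc f v" for u v
  proof -
    let ?A = "Poly_Mapping.keys u \<union> Poly_Mapping.keys v"
    have "Poly_Mapping.keys (u + v) \<subseteq> ?A" by (rule keys_add)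
    then show ?thesis
      by (simp add: lin_ext_superset[OF assms, of ?A] lookup_add scale_left_distrib sum.distrib)
  qed
  moreover have "lin_ext sc f (fscale c u) = sc c (lin_ext sc f u)" for c u
  proof -
    have "Poly_Mapping.keys (fscale c u) \<subseteq> Poly_Mapping.keys u"
      by (auto simp: in_keys_iff lookup_fscale)
    then show ?thesis
      by (simp add: lin_ext_superset[OF assms, of "Poly_Mapping.keys u"] lookup_fscale scale_sum_right)
  qed
  ultimately show ?thesis
    by (simp add: Vector_Spaces.linear_iff assms vector_space_fscale)
qed

lemmas lin_ext_add = module_hom.add[OF linear_lin_ext[unfolded linear_iff_module_hom]]
  and lin_ext_scale = module_hom.scale[OF linear_lin_ext[unfolded linear_iff_module_hom]]
  and lin_ext_diff = module_hom.diff[OF linear_lin_ext[unfolded linear_iff_module_hom]]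

lemma lin_ext_single:
  assumes "vector_space sc" shows "lin_ext sc f (Poly_Mapping.single a c) = sc c (f a)"
proof -
  interpret vector_space sc by fact
  show ?thesis by (simp add: lin_ext_superset[OF assms, of "{a}"])
qed

lemma lin_ext_pure: "vector_space sc \<Longrightarrow> lin_ext sc f (pure a) = f a"
  by (simp add: lin_ext_single vector_space.vector_space_assms(4))

lemma linear_comp_lin_ext:
  assumes "Vector_Spaces.linear sc sc' T"
  shows "T (lin_ext sc f u) = lin_ext sc' (\<lambda>a. T (f a)) u"
proof -
  interpret Vector_Spaces.linear sc sc' T by fact
  show ?thesis by (simp add: lin_ext_def sum scale)
qed

lemma lin_ext_lin_ext:
  assumes "vector_space sc"
  shows "lin_ext sc f (lin_ext fscale t u) = lin_ext sc (\<lambda>a. lin_ext sc f (t a)) u"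
  by (rule linear_comp_lin_ext[OF linear_lin_ext[OF assms]])

lemma lin_ext_fun_add:
  assumes "vector_space sc"
  shows "lin_ext sc (\<lambda>a. f a + h a) u = lin_ext sc f u + lin_ext sc h u"
  by (simp add: lin_ext_def vector_space.vector_space_assms(1)[OF assms] sum.distrib)

section \<open>Multilinear maps out of tensor products\<close>

abbreviation lin_ext2 ::
  "('k::field \<Rightarrow> 'c \<Rightarrow> 'c) \<Rightarrow> ('a \<Rightarrow> 'b \<Rightarrow> 'c::ab_group_add) \<Rightarrow> ('a \<times> 'b \<Rightarrow>\<^sub>0 'k) \<Rightarrow> 'c" where
  "lin_ext2 sc B \<equiv> lin_ext sc (\<lambda>(a, b). B a b)"

abbreviation lin_ext3 ::
  "('k::field \<Rightarrow> 'd \<Rightarrow> 'd) \<Rightarrow> ('a \<Rightarrow> 'b \<Rightarrow> 'c \<Rightarrow> 'd::ab_group_add) \<Rightarrow> ('a \<times> 'b \<times> 'c \<Rightarrow>\<^sub>0 'k) \<Rightarrow> 'd" where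
  "lin_ext3 sc B \<equiv> lin_ext sc (\<lambda>(a, b, c). B a b c)"

text \<open>\<open>Vector_Spaces.linear\<close> carries the vector space axioms of both sides, so
  this predicate also supplies them for \<open>sc\<close>.\<close>

definition bilinear_map ::
  "('k::field \<Rightarrow> 'a::ab_group_add \<Rightarrow> 'a) \<Rightarrow> ('k \<Rightarrow> 'b::ab_group_add \<Rightarrow> 'b) \<Rightarrow> ('a \<Rightarrow> 'a \<Rightarrow> 'b) \<Rightarrow> bool" where
  "bilinear_map scA sc B \<longleftrightarrow>
     (\<forall>a. Vector_Spaces.linear scA sc (B a)) \<and> (\<forall>b. Vector_Spaces.linear scA sc (\<lambda>a. B a b))"

definition trilinear_map ::
  "('k::field \<Rightarrow> 'a::ab_group_add \<Rightarrow> 'a) \<Rightarrow> ('k \<Rightarrow> 'b::ab_group_add \<Rightarrow> 'b) \<Rightarrow> ('a \<Rightarrow> 'a \<Rightarrow> 'a \<Rightarrow> 'b) \<Rightarrow> bool" where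
  "trilinear_map scA sc B \<longleftrightarrow>
     (\<forall>a. bilinear_map scA sc (B a)) \<and> (\<forall>b c. Vector_Spaces.linear scA sc (\<lambda>a. B a b c))"

lemma lin_ext_eq_zero_on_span:
  assumes "vector_space sc" "\<And>r. r \<in> R \<Longrightarrow> lin_ext sc f r = 0" "u - v \<in> module.span fscale R"
  shows "lin_ext sc f u = lin_ext sc f v"
proof -
  interpret module_hom fscale sc "lin_ext sc f"
    using linear_lin_ext[OF assms(1)] by (simp add: module_hom_iff_linear)
  show ?thesis
    using eq_0_on_span[OF assms(2,3)] by (simp add: diff)
qed

text \<open>The universal property of the tensor square: the linear extension of \<open>B\<close>
  kills every bilinearity relation, hence their span. It makes evaluation at a coproduct independent
  of the formal sum chosen to represent it.\<close>

lemma lin_ext2_tensor_eq2: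
  assumes B: "bilinear_map scA sc B" and uv: "tensor_eq2 scA u v"
  shows "lin_ext2 sc B u = lin_ext2 sc B v"
proof -
  have vs: "vector_space sc" using B by (auto simp: bilinear_map_def Vector_Spaces.linear_iff)
  show ?thesis
    by (rule lin_ext_eq_zero_on_span[OF vs _ uv[unfolded tensor_eq2_def]])
      (use B in \<open>auto simp: tensor_rels2_def bilinear_map_def Vector_Spaces.linear_iff lin_ext_diff[OF vs]
        lin_ext_scale[OF vs] lin_ext_pure[OF vs]\<close>)
qed

lemma lin_ext3_tensor_eq3:
  assumes B: "trilinear_map scA sc B" and uv: "tensor_eq3 scA u v"
  shows "lin_ext3 sc B u = lin_ext3 sc B v"
proof -
  have vs: "vector_space sc" using B by (auto simp: trilinear_map_def Vector_Spaces.linear_iff)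
  show ?thesis
    by (rule lin_ext_eq_zero_on_span[OF vs _ uv[unfolded tensor_eq3_def]])
      (use B in \<open>auto simp: tensor_rels3_def trilinear_map_def bilinear_map_def Vector_Spaces.linear_iff
        lin_ext_diff[OF vs] lin_ext_scale[OF vs] lin_ext_pure[OF vs]\<close>)
qed

section \<open>Algebra homomorphisms and presentations\<close>

definition algebra_hom ::
  "('k::field \<Rightarrow> 'a::ring_1 \<Rightarrow> 'a) \<Rightarrow> ('k \<Rightarrow> 'b::ring_1 \<Rightarrow> 'b) \<Rightarrow> ('a \<Rightarrow> 'b) \<Rightarrow> bool" where
  "algebra_hom scA scB \<phi> \<longleftrightarrow> Vector_Spaces.linear scA scB \<phi> \<and> \<phi> 1 = 1 \<and>
     (\<forall>a b. \<phi> (a * b) = \<phi> a * \<phi> b)"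

lemma algebra_character_iff_hom: "algebra_character sc = algebra_hom sc (*)"
  by (simp add: fun_eq_iff algebra_character_def algebra_hom_def)

lemma algebra_hom_power: "algebra_hom sc sc' \<phi> \<Longrightarrow> \<phi> (a ^ n) = \<phi> a ^ n"
  by (induction n) (auto simp: algebra_hom_def)

lemma algebra_hom_comp:
  "algebra_hom sc1 sc2 \<phi> \<Longrightarrow> algebra_hom sc2 sc3 \<psi> \<Longrightarrow> algebra_hom sc1 sc3 (\<lambda>a. \<psi> (\<phi> a))"
  by (auto simp: algebra_hom_def Vector_Spaces.linear_iff)

lemma k_algebra_field: "k_algebra ((*) :: 'k::field \<Rightarrow> 'k \<Rightarrow> 'k)"
  by unfold_locales (auto simp: algebra_simps)

lemma sum_keys_single:
  "(\<Sum>a\<in>Poly_Mapping.keys u. Poly_Mapping.single a (Poly_Mapping.lookup u a)) = u"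
  by (rule poly_mapping_eqI) (simp add: lookup_sum lookup_single when_def in_keys_iff)

lemma poly_mapping_single_induct [case_names single add]:
  fixes u :: "'a \<Rightarrow>\<^sub>0 'b::ab_group_add"
  assumes "\<And>a c. P (Poly_Mapping.single a c)" and "\<And>u v. P u \<Longrightarrow> P v \<Longrightarrow> P (u + v)"
  shows "P u"
proof -
  have "P (\<Sum>a\<in>A. Poly_Mapping.single a (Poly_Mapping.lookup u a))" if "finite A" for A
    using that
  proof (induction A rule: finite_induct)
    case empty
    \<comment> \<open>The zero function is itself a single with coefficient 0, so the induction rule
      gets by without a base case.\<close>
    show ?case using assms(1)[of undefined 0] by simp
  qed (auto intro: assms)
  from this[of "Poly_Mapping.keys u"] show ?thesis
    by (simp add: sum_keys_single)
qed

text \<open>Multiplicativity is additive in each factor, so it reduces to monomials, where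
  concatenated words give products of the corresponding lists.\<close>

lemma algebra_hom_free_eval:
  assumes "k_algebra sc"
  shows "algebra_hom fscale sc (free_eval sc f)"
proof -
  interpret k_algebra sc by fact
  have lin: "Vector_Spaces.linear fscale sc (free_eval sc f)"
    unfolding free_eval_def by (rule linear_lin_ext) unfold_locales
  then interpret L: module_hom fscale sc "free_eval sc f"
    by (simp add: module_hom_iff_linear)
  have eval_single: "free_eval sc f (Poly_Mapping.single w c) = sc c (prod_list (map f (letters w)))" for w c
    unfolding free_eval_def by (rule lin_ext_single) unfold_locales
  have "free_eval sc f (u * v) = free_eval sc f u * free_eval sc f v" for u v
  proof (induction u rule: poly_mapping_single_induct)
    case (single w c)
    show ?case
      by (induction v rule: poly_mapping_single_induct)
        (auto simp: mult_single eval_single plus_free_monoid_def distrib_left L.add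
          scale_mult_left scale_mult_right mult.commute)
  qed (simp add: L.add distrib_right)
  moreover have "free_eval sc f 1 = 1"
    unfolding single_one[symmetric] eval_single by (simp add: zero_free_monoid_def)
  ultimately show ?thesis using lin by (simp add: algebra_hom_def)
qed

lemma free_eval_free_gen: "k_algebra sc \<Longrightarrow> free_eval sc f (free_gen a) = f a"
  by (simp add: free_eval_def free_gen_def lin_ext_pure k_algebra_def)

lemma free_eval_free_const: "k_algebra sc \<Longrightarrow> free_eval sc f (free_const c) = sc c 1"
  by (simp add: free_eval_def free_const_def lin_ext_single k_algebra_def zero_free_monoid_def)

section \<open>Ideals, presentations and their universal property\<close>

lemma two_sided_ideal_kernel: "algebra_hom sc sc' \<phi> \<Longrightarrow> two_sided_ideal {u. \<phi> u = 0}"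
proof -
  assume \<phi>: "algebra_hom sc sc' \<phi>"
  then have "\<phi> 0 = 0"
    unfolding algebra_hom_def Vector_Spaces.linear_iff by (metis add_cancel_right_right)
  with \<phi> show ?thesis
    by (auto simp: two_sided_ideal_def algebra_hom_def Vector_Spaces.linear_iff)
qed

lemma ideal_generated_superset: "R \<subseteq> ideal_generated R"
  by (auto simp: ideal_generated_def)

lemma ideal_generated_least: "two_sided_ideal I \<Longrightarrow> R \<subseteq> I \<Longrightarrow> ideal_generated R \<subseteq> I"
  by (auto simp: ideal_generated_def)

lemma presented_by_relation:
  assumes "presented_by sc f R" "r \<in> R" shows "free_eval sc f r = 0"
  using assms ideal_generated_superset[of R] by (auto simp: presented_by_def)

text \<open>Evaluation is surjective, so every element is a linear combination of words in the
  generators.\<close>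

lemma presented_by_induct [consumes 2, case_names gen one mult add scale]:
  assumes "k_algebra sc" and "presented_by sc f R"
    and gen: "\<And>a. P (f a)" and one: "P 1" and mult: "\<And>a b. P a \<Longrightarrow> P b \<Longrightarrow> P (a * b)"
    and add: "\<And>a b. P a \<Longrightarrow> P b \<Longrightarrow> P (a + b)" and scale: "\<And>c a. P a \<Longrightarrow> P (sc c a)"
  shows "P h"
proof -
  interpret k_algebra sc by fact
  interpret E: module_hom fscale sc "free_eval sc f"
    using algebra_hom_free_eval[OF assms(1), of f] by (simp add: algebra_hom_def module_hom_iff_linear)
  have word: "P (prod_list (map f as))" for as
    by (induction as) (auto intro: one mult gen)
  have "P (free_eval sc f u)" for u
  proof (induction u rule: poly_mapping_single_induct)
    case (single w c)
    have "free_eval sc f (Poly_Mapping.single w c) = sc c (prod_list (map f (letters w)))"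
      unfolding free_eval_def by (rule lin_ext_single) unfold_locales
    then show ?case by (simp add: word scale)
  qed (simp add: E.add add)
  moreover obtain u where "h = free_eval sc f u"
    using assms(2) by (auto simp: presented_by_def surj_def)
  ultimately show ?thesis by simp
qed

text \<open>The kernel of \<open>free_eval sc' f'\<close> is a two-sided ideal containing
  \<open>R\<close>, hence contains the kernel of \<open>free_eval sc f\<close>; the former
  evaluation therefore factors through the latter.\<close>

lemma presented_by_lift:
  assumes "k_algebra sc" "k_algebra sc'" "presented_by sc f R"
    and rel: "\<And>r. r \<in> R \<Longrightarrow> free_eval sc' f' r = 0"
  obtains \<phi> where "algebra_hom sc sc' \<phi>" "\<And>a. \<phi> (f a) = f' a"
proof -
  let ?e = "free_eval sc f" and ?e' = "free_eval sc' f'"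
  have e: "algebra_hom fscale sc ?e" and e': "algebra_hom fscale sc' ?e'"
    using assms by (auto intro: algebra_hom_free_eval)
  interpret E: module_hom fscale sc ?e using e by (simp add: algebra_hom_def module_hom_iff_linear)
  interpret E': module_hom fscale sc' ?e' using e' by (simp add: algebra_hom_def module_hom_iff_linear)
  have "ideal_generated R \<subseteq> {u. ?e' u = 0}"
    by (rule ideal_generated_least[OF two_sided_ideal_kernel[OF e']]) (auto simp: rel)
  then have ker: "?e' u = 0" if "?e u = 0" for u
    using assms(3) that by (auto simp: presented_by_def)
  \<comment> \<open>An arbitrary preimage is chosen; two preimages differ by a kernel element, which
    \<open>ker\<close> sends to 0.\<close>
  define \<phi> where "\<phi> h = ?e' (SOME u. ?e u = h)" for h
  have \<phi>: "\<phi> (?e u) = ?e' u" for u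
  proof -
    have "?e (SOME v. ?e v = ?e u) = ?e u" by (rule someI) simp
    then have "?e ((SOME v. ?e v = ?e u) - u) = 0" by (simp add: E.diff)
    then show ?thesis using ker by (fastforce simp: E'.diff \<phi>_def)
  qed
  have surj: "\<exists>u. h = ?e u" for h
    using assms(3) by (auto simp: presented_by_def surj_def)
  have "\<phi> (a + b) = \<phi> a + \<phi> b \<and> \<phi> (sc c a) = sc' c (\<phi> a) \<and> \<phi> (a * b) = \<phi> a * \<phi> b" for a b c
  proof -
    obtain u v where uv: "a = ?e u" "b = ?e v" using surj by blast
    have "a + b = ?e (u + v)" "sc c a = ?e (fscale c u)" "a * b = ?e (u * v)"
      using e uv by (simp_all add: algebra_hom_def E.add E.scale)
    then show ?thesis using e' by (simp add: uv \<phi> E'.add E'.scale algebra_hom_def)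
  qed
  moreover have "\<phi> 1 = 1"
    using \<phi>[of 1] e e' by (simp add: algebra_hom_def)
  ultimately have "algebra_hom sc sc' \<phi>"
    using assms(1,2) by (auto simp: algebra_hom_def Vector_Spaces.linear_iff k_algebra_def)
  moreover have "\<phi> (f a) = f' a" for a
    using \<phi>[of "free_gen a"] assms(1,2) by (simp add: free_eval_free_gen)
  ultimately show ?thesis by (rule that)
qed

section \<open>Coproducts and antipodes\<close>

lemma unit_inv_eq:
  fixes u v :: "'a::ring_1"
  assumes "u * v = 1" "v * u = 1" shows "unit_inv u = v"
  unfolding unit_inv_def
proof (rule the_equality)
  fix w assume "u * w = 1 \<and> w * u = 1"
  then have "v * (u * w) = v" by simp
  then show "w = v" by (simp add: assms flip: mult.assoc)
qed (use assms in simp)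

context k_algebra
begin

lemma linear_scaleI:
  assumes "\<And>a b. f (a + b) = f a + f b" "\<And>c a. f (scale c a) = scale c (f a)"
  shows "Vector_Spaces.linear scale scale f"
  using assms vector_space_axioms by (auto simp: Vector_Spaces.linear_iff)

lemma lin_ext2_mult_left: "lin_ext2 scale (\<lambda>a b. c * B a b) u = c * lin_ext2 scale B u"
proof -
  have "Vector_Spaces.linear scale scale ((*) c)"
    by (rule linear_scaleI) (simp_all add: distrib_left scale_mult_right)
  from linear_comp_lin_ext[OF this, of "\<lambda>(a, b). B a b" u] show ?thesis by (simp add: split_def)
qed

lemma lin_ext2_mult_right: "lin_ext2 scale (\<lambda>a b. B a b * c) u = lin_ext2 scale B u * c"
proof -
  have "Vector_Spaces.linear scale scale (\<lambda>a. a * c)"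
    by (rule linear_scaleI) (simp_all add: distrib_right scale_mult_left)
  from linear_comp_lin_ext[OF this, of "\<lambda>(a, b). B a b" u] show ?thesis by (simp add: split_def)
qed

lemma lin_ext2_scale: "lin_ext2 scale (\<lambda>a b. scale c (B a b)) u = scale c (lin_ext2 scale B u)"
proof -
  have "Vector_Spaces.linear scale scale (scale c)"
    by (rule linear_scaleI) (simp_all add: scale_right_distrib mult.commute)
  from linear_comp_lin_ext[OF this, of "\<lambda>(a, b). B a b" u] show ?thesis by (simp add: split_def)
qed

end

section \<open>Evaluating multilinear maps on coproducts\<close>

context bialgebra
begin

lemma counit_simps:
  "\<epsilon> 1 = 1" "\<epsilon> (a * b) = \<epsilon> a * \<epsilon> b" "\<epsilon> (a + b) = \<epsilon> a + \<epsilon> b" "\<epsilon> (scale c a) = c * \<epsilon> a"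
  using counit_character by (auto simp: algebra_character_def Vector_Spaces.linear_iff)

text \<open>As a map into formal sums, \<Delta> is linear only up to \<open>tensor_eq2\<close>; a
  bilinear map removes this ambiguity.\<close>

lemma linear_comult:
  assumes "bilinear_map scale sc B"
  shows "Vector_Spaces.linear scale sc (\<lambda>h. lin_ext2 sc B (\<Delta> h))"
proof -
  have vs: "vector_space sc" using assms by (auto simp: bilinear_map_def Vector_Spaces.linear_iff)
  show ?thesis
    unfolding Vector_Spaces.linear_iff
    using lin_ext2_tensor_eq2[OF assms comult_add] lin_ext2_tensor_eq2[OF assms comult_scale]
    by (auto simp: vs vector_space_axioms lin_ext_add[OF vs] lin_ext_scale[OF vs])
qed

lemma lin_ext2_comult_one:
  assumes "bilinear_map scale sc B"
  shows "lin_ext2 sc B (\<Delta> 1) = B 1 1"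
proof -
  have "vector_space sc" using assms by (auto simp: bilinear_map_def Vector_Spaces.linear_iff)
  then show ?thesis
    by (simp add: lin_ext2_tensor_eq2[OF assms comult_one] lin_ext_pure)
qed

lemma bilinear_map_mult_args:
  assumes "bilinear_map scale sc B"
  shows "bilinear_map scale sc (\<lambda>b1 b2. B (a1 * b1) (a2 * b2))"
  using assms
  by (auto simp: bilinear_map_def Vector_Spaces.linear_iff distrib_left scale_mult_right)

lemma lin_ext2_comult_mult:
  assumes "bilinear_map scale sc B"
  shows "lin_ext2 sc B (\<Delta> (a * b)) =
    lin_ext2 sc (\<lambda>a1 a2. lin_ext2 sc (\<lambda>b1 b2. B (a1 * b1) (a2 * b2)) (\<Delta> b)) (\<Delta> a)"
proof -
  have vs: "vector_space sc" using assms by (auto simp: bilinear_map_def Vector_Spaces.linear_iff)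
  show ?thesis
    unfolding lin_ext2_tensor_eq2[OF assms comult_mult]
    by (simp add: tensor_mult_def lin_ext_lin_ext[OF vs] lin_ext_pure[OF vs] split_def)
qed

lemma lin_ext2_comult_mult_right:
  assumes "bilinear_map scale sc B" "tensor_eq2 scale (\<Delta> b) v"
  shows "lin_ext2 sc B (\<Delta> (a * b)) =
    lin_ext2 sc (\<lambda>a1 a2. lin_ext2 sc (\<lambda>b1 b2. B (a1 * b1) (a2 * b2)) v) (\<Delta> a)"
  unfolding lin_ext2_comult_mult[OF assms(1)]
    lin_ext2_tensor_eq2[OF bilinear_map_mult_args[OF assms(1)] assms(2)] ..

text \<open>Such a \<open>B\<close> amounts to an algebra homomorphism on the tensor square,
  composed here with the homomorphism \<Delta>. It later serves for products of characters and for
  the twist in the involution condition.\<close>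

lemma algebra_hom_lin_ext2_comult:
  assumes "k_algebra sc" and B: "bilinear_map scale sc B" and "B 1 1 = 1"
    and mult: "\<And>a b a' b'. B (a * a') (b * b') = B a b * B a' b'"
  shows "algebra_hom scale sc (\<lambda>h. lin_ext2 sc B (\<Delta> h))"
proof -
  interpret T: k_algebra sc by fact
  have "lin_ext2 sc B (\<Delta> (a * b)) = lin_ext2 sc B (\<Delta> a) * lin_ext2 sc B (\<Delta> b)" for a b
    unfolding lin_ext2_comult_mult[OF B] mult
    by (simp add: T.lin_ext2_mult_left T.lin_ext2_mult_right)
  then show ?thesis
    using linear_comult[OF B] lin_ext2_comult_one[OF B] assms(3) by (simp add: algebra_hom_def)
qed

text \<open>Neutrality of \<epsilon> for convolution, transported along a linear map.\<close>

lemma lin_ext2_comult_counit_left: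
  assumes "Vector_Spaces.linear scale sc T"
  shows "lin_ext2 sc (\<lambda>a b. sc (\<epsilon> a) (T b)) (\<Delta> h) = T h"
  using linear_comp_lin_ext[OF assms, of "\<lambda>(a, b). scale (\<epsilon> a) b" "\<Delta> h"] assms
  by (simp add: counit_left[unfolded split_def] split_def Vector_Spaces.linear_iff)

lemma lin_ext2_comult_counit_right:
  assumes "Vector_Spaces.linear scale sc T"
  shows "lin_ext2 sc (\<lambda>a b. sc (\<epsilon> b) (T a)) (\<Delta> h) = T h"
  using linear_comp_lin_ext[OF assms, of "\<lambda>(a, b). scale (\<epsilon> b) a" "\<Delta> h"] assms
  by (simp add: counit_right[unfolded split_def] split_def Vector_Spaces.linear_iff)

lemma lin_ext3_comult_left:
  assumes "vector_space sc"
  shows "lin_ext3 sc T (comult_left \<Delta> h) =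
    lin_ext2 sc (\<lambda>a b. lin_ext2 sc (\<lambda>a1 a2. T a1 a2 b) (\<Delta> a)) (\<Delta> h)"
  by (simp add: comult_left_def lin_ext_lin_ext[OF assms] lin_ext_pure[OF assms] split_def)

lemma lin_ext3_comult_right:
  assumes "vector_space sc"
  shows "lin_ext3 sc T (comult_right \<Delta> h) =
    lin_ext2 sc (\<lambda>a b. lin_ext2 sc (\<lambda>b1 b2. T a b1 b2) (\<Delta> b)) (\<Delta> h)"
  by (simp add: comult_right_def lin_ext_lin_ext[OF assms] lin_ext_pure[OF assms] split_def)

lemma coassoc_lin_ext:
  assumes "trilinear_map scale sc T"
  shows "lin_ext2 sc (\<lambda>a b. lin_ext2 sc (\<lambda>a1 a2. T a1 a2 b) (\<Delta> a)) (\<Delta> h) =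
    lin_ext2 sc (\<lambda>a b. lin_ext2 sc (\<lambda>b1 b2. T a b1 b2) (\<Delta> b)) (\<Delta> h)"
proof -
  have vs: "vector_space sc" using assms by (auto simp: trilinear_map_def Vector_Spaces.linear_iff)
  show ?thesis
    using lin_ext3_tensor_eq3[OF assms coassoc]
    by (simp add: lin_ext3_comult_left[OF vs] lin_ext3_comult_right[OF vs])
qed

text \<open>The inner sum over \<open>\<Delta> a\<close> is linear in \<open>a\<close> and in
  \<open>b\<close>, so the outer coproduct may be replaced by any representative. This allows
  iterated coproducts of generators to be computed from their given coproducts.\<close>

lemma lin_ext3_comult_left_tensor:
  assumes T: "trilinear_map scale sc T" and v: "tensor_eq2 scale (\<Delta> h) v"
  shows "lin_ext3 sc T (comult_left \<Delta> h) =
    lin_ext2 sc (\<lambda>a b. lin_ext2 sc (\<lambda>a1 a2. T a1 a2 b) (\<Delta> a)) v"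
proof -
  have vs: "vector_space sc" using assms by (auto simp: trilinear_map_def Vector_Spaces.linear_iff)
  have "bilinear_map scale sc (\<lambda>a1 a2. T a1 a2 b)" for b
    using T by (auto simp: trilinear_map_def bilinear_map_def)
  note lin = linear_comult[OF this]
  have "bilinear_map scale sc (\<lambda>a b. lin_ext2 sc (\<lambda>a1 a2. T a1 a2 b) (\<Delta> a))"
  proof -
    have "lin_ext2 sc (\<lambda>a1 a2. T a1 a2 (b + b')) (\<Delta> a) =
        lin_ext2 sc (\<lambda>a1 a2. T a1 a2 b) (\<Delta> a) + lin_ext2 sc (\<lambda>a1 a2. T a1 a2 b') (\<Delta> a)" for a b b'
      using T by (simp add: trilinear_map_def bilinear_map_def Vector_Spaces.linear_iff split_def
          flip: lin_ext_fun_add[OF vs])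
    moreover have "lin_ext2 sc (\<lambda>a1 a2. T a1 a2 (scale c b)) (\<Delta> a) =
        sc c (lin_ext2 sc (\<lambda>a1 a2. T a1 a2 b) (\<Delta> a))" for a b c
    proof -
      have "Vector_Spaces.linear sc sc (sc c)"
        using vs by (auto simp: Vector_Spaces.linear_iff vector_space_def mult.commute)
      from linear_comp_lin_ext[OF this, of "\<lambda>(a1, a2). T a1 a2 b" "\<Delta> a"] show ?thesis
        using T by (simp add: trilinear_map_def bilinear_map_def Vector_Spaces.linear_iff split_def)
    qed
    ultimately show ?thesis
      using lin vs by (auto simp: bilinear_map_def Vector_Spaces.linear_iff vector_space_axioms)
  qed
  from lin_ext2_tensor_eq2[OF this v] show ?thesis
    by (simp add: lin_ext3_comult_left[OF vs])
qed

text \<open>The counit axiom gives \<open>scale (\<epsilon> u) u = u\<close>; cancelling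
  \<open>u\<close> by \<open>v\<close> and applying \<epsilon> leaves
  \<open>\<epsilon> u = 1\<close>.\<close>

lemma group_likeI:
  assumes "tensor_eq2 scale (\<Delta> u) (pure (u, u))" "u * v = 1"
  shows "group_like scale \<Delta> \<epsilon> u"
proof -
  have "bilinear_map scale scale (\<lambda>a b. scale (\<epsilon> a) b)"
    by (auto simp: bilinear_map_def counit_simps algebra_simps intro!: linear_scaleI)
  from lin_ext2_tensor_eq2[OF this assms(1)] have "scale (\<epsilon> u) u = u"
    by (simp add: counit_left lin_ext_pure[OF vector_space_axioms])
  then have "scale (\<epsilon> u) u * v = u * v" by simp
  then have "scale (\<epsilon> u) 1 = 1" by (simp add: scale_mult_left assms(2))
  then have "\<epsilon> (scale (\<epsilon> u) 1) = 1" by (simp add: counit_simps)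
  then show ?thesis using assms(1) by (simp add: group_like_def counit_simps)
qed

lemma group_like_one: "group_like scale \<Delta> \<epsilon> 1"
  using comult_one by (simp add: group_like_def counit_simps)

text \<open>In the left counit axiom the summand \<open>1 \<otimes> z\<close> already yields
  \<open>z\<close>, so the other one, \<open>scale (\<epsilon> z) u\<close>, vanishes;
  \<open>u\<close> is then cancelled.\<close>

lemma counit_skew_primitive:
  assumes "tensor_eq2 scale (\<Delta> z) (pure (1, z) + pure (z, u))" "u * v = 1"
  shows "\<epsilon> z = 0"
proof -
  have "bilinear_map scale scale (\<lambda>a b. scale (\<epsilon> a) b)"
    by (auto simp: bilinear_map_def counit_simps algebra_simps intro!: linear_scaleI)
  from lin_ext2_tensor_eq2[OF this assms(1)] have "scale (\<epsilon> z) u = 0"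
    by (simp add: counit_left lin_ext_pure lin_ext_add vector_space_axioms counit_simps)
  then have "scale (\<epsilon> z) u * v = 0" by auto
  then have "scale (\<epsilon> z) 1 = 0" by (simp add: scale_mult_left assms(2))
  then have "\<epsilon> (scale (\<epsilon> z) 1) = \<epsilon> (scale 0 1)" by simp
  then show ?thesis by (simp only: counit_simps) simp
qed

end

section \<open>Uniqueness of the antipode and its values on products\<close>

context hopf_algebra
begin

lemma antipode_simps:
  "S (a + b) = S a + S b" "S (scale c a) = scale c (S a)" "S (- a) = - S a"
proof -
  interpret module_hom scale scale S
    using antipode_linear by (simp add: module_hom_iff_linear)
  show "S (a + b) = S a + S b" "S (scale c a) = scale c (S a)" "S (- a) = - S a"
    by (simp_all add: add scale neg)
qed

lemma bilinear_antipode_mult: "bilinear_map scale scale (\<lambda>a b. S a * b)"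
  by (auto simp: bilinear_map_def algebra_simps antipode_simps scale_mult_left scale_mult_right
      intro!: linear_scaleI)

lemma antipode_one: "S 1 = 1"
  using antipode_left[of 1] by (simp add: lin_ext2_comult_one[OF bilinear_antipode_mult] counit_simps)

text \<open>Convolve \<open>T * id = c \<epsilon>\<close> with the antipode on the right.\<close>

lemma antipode_unique_left:
  assumes T: "Vector_Spaces.linear scale scale T"
    and conv: "\<And>h. lin_ext2 scale (\<lambda>a b. T a * b) (\<Delta> h) = scale (\<epsilon> h) c"
  shows "T h = c * S h"
proof -
  have tri: "trilinear_map scale scale (\<lambda>a b d. T a * b * S d)"
    using T by (auto simp: trilinear_map_def bilinear_map_def algebra_simps antipode_simps
        scale_mult_left scale_mult_right Vector_Spaces.linear_iff)
  have "T h = lin_ext2 scale (\<lambda>a b. scale (\<epsilon> b) (T a)) (\<Delta> h)"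
    by (rule lin_ext2_comult_counit_right[OF T, symmetric])
  also have "\<dots> = lin_ext2 scale (\<lambda>a b. lin_ext2 scale (\<lambda>b1 b2. T a * b1 * S b2) (\<Delta> b)) (\<Delta> h)"
    by (simp add: mult.assoc lin_ext2_mult_left antipode_right scale_mult_right)
  also have "\<dots> = lin_ext2 scale (\<lambda>a b. lin_ext2 scale (\<lambda>a1 a2. T a1 * a2 * S b) (\<Delta> a)) (\<Delta> h)"
    by (rule coassoc_lin_ext[OF tri, symmetric])
  also have "\<dots> = lin_ext2 scale (\<lambda>a b. scale (\<epsilon> a) (c * S b)) (\<Delta> h)"
    by (simp add: lin_ext2_mult_right conv scale_mult_left)
  also have "\<dots> = c * S h"
    by (rule lin_ext2_comult_counit_left, rule linear_scaleI)
      (simp_all add: antipode_simps distrib_left scale_mult_right)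
  finally show ?thesis .
qed

text \<open>Conjugating the antipode axiom for \<open>h * u\<close> by \<open>u\<close> shows that
  \<open>h \<mapsto> u * S (h * u)\<close> is a left convolution inverse of the identity, so it
  equals \<open>S\<close>.\<close>

lemma antipode_mult_group_like:
  assumes u: "group_like scale \<Delta> \<epsilon> u" and v: "u * v = 1" "v * u = 1"
  shows "S (h * u) = v * S h"
proof -
  have tens: "tensor_eq2 scale (\<Delta> u) (pure (u, u))" and "\<epsilon> u = 1"
    using u by (auto simp: group_like_def)
  have "u * S (h * u) = 1 * S h"
  proof (rule antipode_unique_left)
    show "Vector_Spaces.linear scale scale (\<lambda>h. u * S (h * u))"
      by (rule linear_scaleI)
        (simp_all add: antipode_simps distrib_left distrib_right scale_mult_left scale_mult_right)
    fix h
    have "lin_ext2 scale (\<lambda>a b. S (a * u) * (b * u)) (\<Delta> h) = scale (\<epsilon> h) 1"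
      using lin_ext2_comult_mult_right[OF bilinear_antipode_mult tens, of h] antipode_left[of "h * u"]
      by (simp add: lin_ext_pure[OF vector_space_axioms] counit_simps \<open>\<epsilon> u = 1\<close>)
    then have "u * lin_ext2 scale (\<lambda>a b. S (a * u) * (b * u)) (\<Delta> h) * v = scale (\<epsilon> h) 1"
      by (simp add: scale_mult_left scale_mult_right v)
    then show "lin_ext2 scale (\<lambda>a b. u * S (a * u) * b) (\<Delta> h) = scale (\<epsilon> h) 1"
      by (simp add: mult.assoc v flip: lin_ext2_mult_left lin_ext2_mult_right)
  qed
  then have "v * (u * S (h * u)) = v * S h" by simp
  then show ?thesis by (simp add: v flip: mult.assoc)
qed

text \<open>The antipode axiom for \<open>h * z\<close>, whose counit is 0, splits along the two
  summands of \<open>\<Delta> z\<close>. The first sum is \<open>scale (\<epsilon> h) z\<close>;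
  after multiplication by \<open>v\<close> the second is the convolution of
  \<open>h \<mapsto> S (h * z)\<close> with the identity, which is what
  \<open>antipode_unique_left\<close> requires.\<close>

lemma antipode_mult_skew_primitive:
  assumes z: "tensor_eq2 scale (\<Delta> z) (pure (1, z) + pure (z, u))"
    and v: "u * v = 1" "v * u = 1"
  shows "S (h * z) = - (z * v) * S h"
proof (rule antipode_unique_left)
  show "Vector_Spaces.linear scale scale (\<lambda>h. S (h * z))"
    by (rule linear_scaleI)
      (simp_all add: antipode_simps distrib_left distrib_right scale_mult_left scale_mult_right)
  fix h
  let ?c = "lin_ext2 scale (\<lambda>a b. S (a * z) * b) (\<Delta> h)"
  have "lin_ext2 scale (\<lambda>a b. S a * (b * z) + S (a * z) * (b * u)) (\<Delta> h) = 0"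
    using lin_ext2_comult_mult_right[OF bilinear_antipode_mult z, of h] antipode_left[of "h * z"]
    by (simp add: lin_ext_pure[OF vector_space_axioms] lin_ext_add[OF vector_space_axioms]
        counit_simps counit_skew_primitive[OF z v(1)])
  also have "lin_ext2 scale (\<lambda>a b. S a * (b * z) + S (a * z) * (b * u)) (\<Delta> h) =
      lin_ext2 scale (\<lambda>a b. S a * b * z) (\<Delta> h) + lin_ext2 scale (\<lambda>a b. S (a * z) * b * u) (\<Delta> h)"
    by (simp add: mult.assoc split_def flip: lin_ext_fun_add[OF vector_space_axioms])
  finally have "scale (\<epsilon> h) z + ?c * u = 0"
    by (simp add: lin_ext2_mult_right antipode_left scale_mult_left)
  then have "(scale (\<epsilon> h) z + ?c * u) * v = 0" by simp
  then have "scale (\<epsilon> h) (z * v) + ?c = 0"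
    by (simp add: distrib_right scale_mult_left mult.assoc v)
  then show "?c = scale (\<epsilon> h) (- (z * v))" by (simp add: eq_neg_iff_add_eq_0 add.commute)
qed

lemma antipode_group_like:
  assumes "group_like scale \<Delta> \<epsilon> l"
  shows "S l * l = 1" "l * S l = 1"
proof -
  have l: "tensor_eq2 scale (\<Delta> l) (pure (l, l))" "\<epsilon> l = 1"
    using assms by (auto simp: group_like_def)
  have "bilinear_map scale scale (\<lambda>a b. a * S b)"
    by (auto simp: bilinear_map_def algebra_simps antipode_simps scale_mult_left scale_mult_right
        intro!: linear_scaleI)
  from lin_ext2_tensor_eq2[OF this l(1)] lin_ext2_tensor_eq2[OF bilinear_antipode_mult l(1)]
  show "S l * l = 1" "l * S l = 1"
    by (simp_all add: antipode_left antipode_right lin_ext_pure[OF vector_space_axioms] l)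
qed

end

section \<open>Roots of unity\<close>

lemma primitive_root_power_eq_one:
  assumes "primitive_root_of_unity n q" and "q ^ m = 1" shows "n dvd m"
proof (rule ccontr)
  assume "\<not> n dvd m"
  then have "0 < m mod n" "m mod n < n"
    using assms(1) by (auto simp: primitive_root_of_unity_def mod_greater_zero_iff_not_dvd)
  moreover have "q ^ m = (q ^ n) ^ (m div n) * q ^ (m mod n)"
    by (simp flip: power_mult power_add)
  ultimately show False
    using assms by (auto simp: primitive_root_of_unity_def)
qed

lemma primitive_root_nonzero: "primitive_root_of_unity n q \<Longrightarrow> q \<noteq> 0"
  by (auto simp: primitive_root_of_unity_def power_0_left)

text \<open>Divisibility is taken over the integers, where the difference of exponents makes sense
  in either order.\<close>

lemma primitive_root_power_eq:
  assumes "primitive_root_of_unity n q" and "q ^ a = q ^ b" shows "int n dvd int a - int b"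
proof -
  have *: "int n dvd int c - int d" if "q ^ c = q ^ d" "d \<le> c" for c d
  proof -
    have "q ^ (c - d) * q ^ d = 1 * q ^ d"
      using that by (simp flip: power_add)
    then have "n dvd c - d"
      using assms(1) primitive_root_nonzero[OF assms(1)]
      by (intro primitive_root_power_eq_one) auto
    then have "int n dvd int (c - d)" by (simp only: int_dvd_int_iff)
    then show ?thesis using that by (simp add: of_nat_diff)
  qed
  show ?thesis
    using *[of a b] *[of b a] assms(2) by (cases "b \<le> a") (auto simp: dvd_diff_commute)
qed

text \<open>The polynomial \<open>monom 1 n - 1\<close> has at most \<open>n\<close> roots, and the
  powers of \<open>q\<close> with exponent below \<open>n\<close> already provide \<open>n\<close>
  distinct ones.\<close>

lemma root_of_unity_is_power:
  fixes q z :: "'k::field"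
  assumes q: "primitive_root_of_unity n q" and z: "z ^ n = 1"
  obtains j where "z = q ^ j"
proof -
  let ?P = "monom 1 n - 1 :: 'k poly"
  have n: "0 < n" and qn: "q ^ n = 1" using q by (auto simp: primitive_root_of_unity_def)
  have "coeff ?P n = 1" using n by (simp add: one_pCons coeff_pCons split: nat.split)
  then have P0: "?P \<noteq> 0" by (metis coeff_0 zero_neq_one)
  have deg: "degree ?P \<le> n"
    by (rule degree_diff_le) (auto simp: degree_monom_le)
  have inj: "inj_on (\<lambda>j. q ^ j) {..<n}"
  proof (rule inj_onI)
    fix i j assume *: "i \<in> {..<n}" "j \<in> {..<n}" "q ^ i = q ^ j"
    then have "int n dvd int i - int j" by (intro primitive_root_power_eq[OF q])
    then have "int i mod int n = int j mod int n" by (simp add: mod_eq_dvd_iff)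
    with * show "i = j" by (simp flip: of_nat_mod)
  qed
  have "(\<lambda>j. q ^ j) ` {..<n} = {w. poly ?P w = 0}"
  proof (rule card_seteq)
    show "finite {w. poly ?P w = 0}" using P0 by (rule poly_roots_finite)
    have "(q ^ j) ^ n = 1" for j
      by (metis power_mult mult.commute power_one qn)
    then show "(\<lambda>j. q ^ j) ` {..<n} \<subseteq> {w. poly ?P w = 0}" by (auto simp: poly_monom)
    have "card {w. poly ?P w = 0} \<le> n"
      using P0 deg card_poly_roots_bound[of ?P] by linarith
    then show "card {w. poly ?P w = 0} \<le> card ((\<lambda>j. q ^ j) ` {..<n})"
      by (simp add: card_image[OF inj])
  qed
  with z that show ?thesis by (auto simp: poly_monom set_eq_iff image_iff)
qed

section \<open>Upper triangular \<open>2 \<times> 2\<close> matrices\<close>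

text \<open>Triangular shape keeps both diagonal projections multiplicative, so a representation
  contains two characters, while the upper entry lets \<open>x\<close> or \<open>y\<close> act by a
  nonzero matrix, as no character can.\<close>

datatype 'k utri = UTri (diag1: 'k) (upper: 'k) (diag2: 'k)

instantiation utri :: (field) ring_1
begin

definition "0 = UTri 0 0 0"
definition "1 = UTri 1 0 1"
definition "u + v = UTri (diag1 u + diag1 v) (upper u + upper v) (diag2 u + diag2 v)"
definition "u - v = UTri (diag1 u - diag1 v) (upper u - upper v) (diag2 u - diag2 v)"
definition "- u = UTri (- diag1 u) (- upper u) (- diag2 u)"
definition "u * v =
  UTri (diag1 u * diag1 v) (diag1 u * upper v + upper u * diag2 v) (diag2 u * diag2 v)"

instance
  by standard (auto intro: utri.expand simp: zero_utri_def one_utri_def plus_utri_def minus_utri_def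
      uminus_utri_def times_utri_def algebra_simps)

end

definition utri_scale :: "'k::field \<Rightarrow> 'k utri \<Rightarrow> 'k utri" where
  "utri_scale c u = UTri (c * diag1 u) (c * upper u) (c * diag2 u)"

lemmas utri_simps =
  zero_utri_def one_utri_def plus_utri_def minus_utri_def uminus_utri_def times_utri_def utri_scale_def

lemma k_algebra_utri: "k_algebra utri_scale"
  by unfold_locales (auto simp: utri_simps algebra_simps)

lemma UTri_diagonal_power: "UTri a 0 b ^ n = UTri (a ^ n) 0 (b ^ n)"
  by (induction n) (auto simp: utri_simps)

lemma UTri_upper_power: "2 \<le> n \<Longrightarrow> UTri 0 b 0 ^ n = 0"
proof -
  assume "2 \<le> n"
  then obtain m where "n = Suc (Suc m)" by (metis add_2_eq_Suc le_Suc_ex)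
  then show ?thesis by (simp add: utri_simps)
qed

lemma algebra_hom_diag: "algebra_hom utri_scale (*) diag1" "algebra_hom utri_scale (*) diag2"
  using k_algebra_utri k_algebra_field
  by (auto simp: algebra_hom_def Vector_Spaces.linear_iff k_algebra_def utri_simps)

section \<open>The defining relations\<close>

text \<open>One direction extracts the relations between \<open>g\<close>, \<open>x\<close> and
  \<open>y\<close> in the presented algebra; the other checks candidate images in
  \<open>algebra_hom_lift\<close>.\<close>

lemma free_eval_hopf_relations_iff:
  fixes G X Y :: "'b::ring_1"
  assumes "k_algebra sc"
  shows "(\<forall>r\<in>hopf_relations p s q. free_eval sc (case_generator G X Y) r = 0) \<longleftrightarrow>
    G * X = sc q (X * G) \<and> G * Y = sc (inverse q ^ s) (Y * G) \<and> G ^ p = 1 \<and> X ^ p = 0 \<and> Y ^ p = 0 \<and>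
    X * Y = sc (inverse q ^ s) (Y * X)"
proof -
  interpret k_algebra sc by fact
  let ?e = "free_eval sc (case_generator G X Y)"
  have e: "algebra_hom fscale sc ?e" using assms by (rule algebra_hom_free_eval)
  then interpret E: module_hom fscale sc ?e by (simp add: algebra_hom_def module_hom_iff_linear)
  have "?e (u * v) = ?e u * ?e v" "?e 1 = 1" for u v using e by (auto simp: algebra_hom_def)
  then show ?thesis
    by (simp add: hopf_relations_def Let_def E.diff algebra_hom_power[OF e] scale_mult_left
        free_eval_free_gen[OF assms] free_eval_free_const[OF assms])
qed

locale presented_hopf_algebra = hopf_algebra scale \<Delta> \<epsilon> S
  for scale :: "'k::field \<Rightarrow> 'h::ring_1 \<Rightarrow> 'h" and \<Delta> \<epsilon> S +
  fixes g x y :: 'h and p s :: nat and q :: 'k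
  assumes p: "prime p" and s: "s \<in> {0..<p} - {0}"
    and q: "primitive_root_of_unity p q"
    and presented: "presented_by scale (case_generator g x y) (hopf_relations p s q)"
    and comult_g: "tensor_eq2 scale (\<Delta> g) (pure (g, g))"
    and comult_x: "tensor_eq2 scale (\<Delta> x) (pure (1, x) + pure (x, g))"
    and comult_y: "tensor_eq2 scale (\<Delta> y) (pure (1, y) + pure (y, g ^ s))"
begin

abbreviation r :: 'k where "r \<equiv> inverse q ^ s"
text \<open>By \<open>g ^ p = 1\<close> this is the inverse of \<open>g\<close>.\<close>

definition g' :: 'h where "g' = g ^ (p - 1)"

lemma relations:
  "g * x = scale q (x * g)" "g * y = scale r (y * g)" "g ^ p = 1" "x ^ p = 0" "y ^ p = 0"
  "x * y = scale r (y * x)"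
  using presented_by_relation[OF presented] free_eval_hopf_relations_iff[OF k_algebra_axioms]
  by metis+

lemma q_nonzero: "q \<noteq> 0"
  using q by (rule primitive_root_nonzero)

lemma q_power_p: "q ^ p = 1"
  using q by (simp add: primitive_root_of_unity_def)

lemma r_power_p: "r ^ p = 1"
proof -
  have "r ^ p = inverse ((q ^ p) ^ s)"
    by (simp add: power_inverse mult.commute flip: power_mult)
  then show ?thesis by (simp add: q_power_p)
qed

text \<open>The exponents 1 and \<open>s\<close> lie strictly between 0 and \<open>p\<close>, so
  primitivity applies to both.\<close>

lemma q_neq_one: "q \<noteq> 1" and r_neq_one: "r \<noteq> 1"
proof -
  show "q \<noteq> 1"
    using q prime_gt_1_nat[OF p] unfolding primitive_root_of_unity_def by force
  show "r \<noteq> 1"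
    using q s by (auto simp: primitive_root_of_unity_def power_inverse)
qed

lemma g_inverse: "g * g' = 1" "g' * g = 1"
proof -
  have "g ^ (Suc (p - 1)) = 1" using relations(3) prime_gt_0_nat[OF p] by simp
  then show "g * g' = 1" "g' * g = 1" by (simp_all add: g'_def flip: power_Suc power_Suc2)
qed

lemma g_power_inverse: "g ^ n * g' ^ n = 1" "g' ^ n * g ^ n = 1"
  using g_inverse by (auto intro: left_right_inverse_power)

lemma generator_induct [case_names g x y one mult add scale]:
  assumes "P g" "P x" "P y" "P 1" "\<And>a b. P a \<Longrightarrow> P b \<Longrightarrow> P (a * b)"
    "\<And>a b. P a \<Longrightarrow> P b \<Longrightarrow> P (a + b)" "\<And>c a. P a \<Longrightarrow> P (scale c a)"
  shows "P h"
proof (rule presented_by_induct[OF k_algebra_axioms presented])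
  show "P (case a of Gen_g \<Rightarrow> g | Gen_x \<Rightarrow> x | Gen_y \<Rightarrow> y)" for a
    by (cases a) (use assms in auto)
qed (use assms in auto)

lemma algebra_hom_eqI:
  assumes "algebra_hom scale sc \<phi>" "algebra_hom scale sc \<psi>" "\<phi> g = \<psi> g" "\<phi> x = \<psi> x" "\<phi> y = \<psi> y"
  shows "\<phi> = \<psi>"
proof
  show "\<phi> h = \<psi> h" for h
    by (induction h rule: generator_induct)
      (use assms in \<open>auto simp: algebra_hom_def Vector_Spaces.linear_iff\<close>)
qed

lemma algebra_antihom_eqI:
  assumes "algebra_antihom scale \<phi>" "algebra_antihom scale \<psi>" "\<phi> g = \<psi> g" "\<phi> x = \<psi> x" "\<phi> y = \<psi> y"
  shows "\<phi> = \<psi>"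
proof
  show "\<phi> h = \<psi> h" for h
    by (induction h rule: generator_induct)
      (use assms in \<open>auto simp: algebra_antihom_def Vector_Spaces.linear_iff\<close>)
qed

lemma algebra_hom_lift:
  fixes G X Y :: "'b::ring_1"
  assumes "k_algebra sc"
    and "G * X = sc q (X * G)" "G * Y = sc r (Y * G)" "G ^ p = 1" "X ^ p = 0" "Y ^ p = 0"
      "X * Y = sc r (Y * X)"
  obtains \<phi> where "algebra_hom scale sc \<phi>" "\<phi> g = G" "\<phi> x = X" "\<phi> y = Y"
proof -
  have "\<forall>r\<in>hopf_relations p s q. free_eval sc (case_generator G X Y) r = 0"
    using assms by (simp add: free_eval_hopf_relations_iff)
  then obtain \<phi> where "algebra_hom scale sc \<phi>"
    and \<phi>: "\<And>a. \<phi> (case_generator g x y a) = case_generator G X Y a"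
    using presented_by_lift[OF k_algebra_axioms assms(1) presented] by blast
  then show ?thesis using that \<phi>[of Gen_g] \<phi>[of Gen_x] \<phi>[of Gen_y] by simp
qed

section \<open>The antipode\<close>

lemma group_like_g: "group_like scale \<Delta> \<epsilon> g"
  using comult_g g_inverse(1) by (rule group_likeI)

lemma antipode_mult_generator:
  "S (h * g) = g' * S h" "S (h * x) = - (x * g') * S h" "S (h * y) = - (y * g' ^ s) * S h"
  using antipode_mult_group_like[OF group_like_g g_inverse]
    antipode_mult_skew_primitive[OF comult_x g_inverse]
    antipode_mult_skew_primitive[OF comult_y g_power_inverse] by blast+

lemma antipode_generator: "S g = g'" "S x = - (x * g')" "S y = - (y * g' ^ s)"
  using antipode_mult_generator[of 1] by (simp_all add: antipode_one)

text \<open>Induction on the right factor with the left one arbitrary: right multiplication by a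
  generator is known from uniqueness of the antipode, and a product \<open>b * c\<close> is handled
  by reassociating.\<close>

lemma antipode_mult: "S (a * b) = S b * S a"
proof (induction b arbitrary: a rule: generator_induct)
  case (mult b c)
  have "S (a * (b * c)) = S ((a * b) * c)" by (simp add: mult.assoc)
  also have "\<dots> = S c * (S b * S a)" by (simp only: mult.IH)
  also have "\<dots> = S (b * c) * S a" by (simp only: mult.IH mult.assoc)
  finally show ?case .
qed (simp_all only: antipode_mult_generator antipode_generator antipode_one antipode_simps mult_1_left
    mult_1_right distrib_left distrib_right scale_mult_left scale_mult_right)

lemma algebra_antihom_antipode: "algebra_antihom scale S"
  by (simp add: algebra_antihom_def antipode_linear antipode_one antipode_mult)

lemma algebra_hom_antipode_square: "algebra_hom scale scale (\<lambda>h. S (S h))"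
  by (auto simp: algebra_hom_def antipode_mult antipode_one antipode_simps intro!: linear_scaleI)

lemma g_power_mult_y: "g ^ n * y = scale (r ^ n) (y * g ^ n)"
proof (induction n)
  case (Suc n)
  have "g ^ Suc n * y = g * (g ^ n * y)" by (simp add: mult.assoc)
  also have "\<dots> = scale (r ^ n) (g * y * g ^ n)" by (simp add: Suc scale_mult_right mult.assoc)
  also have "\<dots> = scale (r ^ Suc n) (y * g ^ Suc n)"
    by (simp add: relations(2) scale_mult_left mult.assoc mult.commute)
  finally show ?case .
qed simp

lemma conj_g_x: "g * x * g' = scale q x"
  by (simp add: relations(1) scale_mult_left mult.assoc g_inverse)

lemma conj_g_power_y: "g ^ n * y * g' ^ n = scale (r ^ n) y"
  by (simp add: g_power_mult_y scale_mult_left mult.assoc g_power_inverse)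

lemma antipode_g': "S g' = g"
proof -
  have "S (g * g') = S g' * g'" by (simp only: antipode_mult antipode_generator)
  then have "S g' * g' * g = g" by (simp only: g_inverse antipode_one mult_1_left)
  then show ?thesis by (simp only: mult.assoc g_inverse mult_1_right)
qed

lemma antipode_power: "S (a ^ n) = S a ^ n"
  by (induction n) (simp_all add: antipode_one antipode_mult power_commutes)

text \<open>Antimultiplicativity turns the square of \<open>S\<close> into conjugation by
  \<open>g\<close> on \<open>x\<close> and by \<open>g ^ s\<close> on \<open>y\<close>; the
  commutation relations evaluate these conjugations.\<close>

lemma antipode_square_generator:
  "S (S g) = g" "S (S x) = scale q x" "S (S y) = scale (r ^ s) y"
proof -
  show "S (S g) = g" by (simp only: antipode_generator antipode_g')
  show "S (S x) = scale q x"
    by (simp only: antipode_generator antipode_simps antipode_mult antipode_g' minus_mult_right[symmetric]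
        minus_minus conj_g_x[symmetric] mult.assoc)
  show "S (S y) = scale (r ^ s) y"
    by (simp only: antipode_generator antipode_simps antipode_mult antipode_g' antipode_power
        minus_mult_right[symmetric] minus_minus conj_g_power_y[symmetric] mult.assoc)
qed

end

section \<open>Modular pairs in involution\<close>

context hopf_algebra
begin

text \<open>The right-hand side of the involution condition as a map of \<open>h\<close>, to be
  compared with the square of \<open>S\<close> on generators.\<close>

definition mpi_twist :: "'a \<Rightarrow> ('a \<Rightarrow> 'k) \<Rightarrow> 'a \<Rightarrow> 'a" where
  "mpi_twist l \<beta> h = lin_ext3 scale (\<lambda>h1 h2 h3. scale (\<beta> h1 * (\<beta> \<circ> S) h3) (l * h2 * unit_inv l))
     (comult_left \<Delta> h)"

lemma modular_pair_in_involution_iff: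
  "modular_pair_in_involution scale \<Delta> \<epsilon> S l \<beta> \<longleftrightarrow>
     group_like scale \<Delta> \<epsilon> l \<and> algebra_hom scale (*) \<beta> \<and> \<beta> l = 1 \<and> (\<forall>h. S (S h) = mpi_twist l \<beta> h)"
  by (simp add: modular_pair_in_involution_def mpi_twist_def algebra_character_iff_hom)

lemma trilinear_mpi_twist:
  assumes "algebra_hom scale (*) \<beta>"
  shows "trilinear_map scale scale (\<lambda>h1 h2 h3. scale (\<beta> h1 * (\<beta> \<circ> S) h3) (l * h2 * l'))"
  using assms by (auto simp: trilinear_map_def bilinear_map_def algebra_hom_def Vector_Spaces.linear_iff
      antipode_simps algebra_simps scale_mult_left scale_mult_right)

lemma mpi_twist_group_like:
  assumes "algebra_hom scale (*) \<beta>" and u: "tensor_eq2 scale (\<Delta> u) (pure (u, u))"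
  shows "mpi_twist l \<beta> u = scale (\<beta> u * \<beta> (S u)) (l * u * unit_inv l)"
proof -
  note tri = trilinear_mpi_twist[OF assms(1), of l "unit_inv l"]
  then have bil: "bilinear_map scale scale (\<lambda>a b. scale (\<beta> a * (\<beta> \<circ> S) d) (l * b * unit_inv l))" for d
    by (auto simp: trilinear_map_def bilinear_map_def)
  show ?thesis
    unfolding mpi_twist_def lin_ext3_comult_left_tensor[OF tri u]
    using lin_ext2_tensor_eq2[OF bil u] by (simp add: lin_ext_pure vector_space_axioms)
qed

text \<open>The iterated coproduct of \<open>z\<close> is \<open>1 \<otimes> 1 \<otimes> z + 1
  \<otimes> z \<otimes> u + z \<otimes> u \<otimes> u\<close>. The outer terms die because \<beta>
  vanishes on \<open>S z\<close> and on \<open>z\<close>.\<close>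

lemma mpi_twist_skew_primitive:
  assumes "algebra_hom scale (*) \<beta>" and z: "tensor_eq2 scale (\<Delta> z) (pure (1, z) + pure (z, u))"
    and "\<beta> z = 0" "\<beta> (S z) = 0" and l: "unit_inv l * l = 1" "l * unit_inv l = 1"
  shows "mpi_twist l \<beta> z = scale (\<beta> (S u)) (l * z * unit_inv l)"
proof -
  note tri = trilinear_mpi_twist[OF assms(1), of l "unit_inv l"]
  then have bil: "bilinear_map scale scale (\<lambda>a b. scale (\<beta> a * (\<beta> \<circ> S) d) (l * b * unit_inv l))" for d
    by (auto simp: trilinear_map_def bilinear_map_def)
  have "\<beta> 1 = 1" using assms(1) by (simp add: algebra_hom_def)
  then show ?thesis
    unfolding mpi_twist_def lin_ext3_comult_left_tensor[OF tri z]
    using lin_ext2_comult_one[OF bil] lin_ext2_tensor_eq2[OF bil z] assms(3,4)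
    by (simp add: lin_ext_add lin_ext_pure vector_space_axioms)
qed

text \<open>The twist is a convolution in two stages: \<beta> with conjugation by \<open>l\<close>,
  then the result with \<open>\<beta> \<circ> S\<close>. Each stage preserves products because one
  of the two factors takes central, scalar values.\<close>

lemma algebra_hom_mpi_twist:
  assumes \<beta>: "algebra_hom scale (*) \<beta>" and \<gamma>: "algebra_hom scale (*) (\<beta> \<circ> S)"
    and l: "unit_inv l * l = 1" "l * unit_inv l = 1"
  shows "algebra_hom scale scale (mpi_twist l \<beta>)"
proof -
  define \<phi> where "\<phi> h = lin_ext2 scale (\<lambda>a b. scale (\<beta> a) (l * b * unit_inv l)) (\<Delta> h)" for h
  note k = k_algebra_axioms
  have conj: "l * (b * b') * unit_inv l = (l * b * unit_inv l) * (l * b' * unit_inv l)" for b b'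
  proof -
    have "(l * b * unit_inv l) * (l * b' * unit_inv l) = l * b * (unit_inv l * l) * b' * unit_inv l"
      by (simp only: mult.assoc)
    then show ?thesis by (simp add: l mult.assoc)
  qed
  have \<phi>: "algebra_hom scale scale \<phi>"
    unfolding \<phi>_def
  proof (rule algebra_hom_lin_ext2_comult[OF k])
    show "bilinear_map scale scale (\<lambda>a b. scale (\<beta> a) (l * b * unit_inv l))"
      using \<beta> by (auto simp: bilinear_map_def algebra_hom_def Vector_Spaces.linear_iff
          algebra_simps scale_mult_left scale_mult_right)
    show "scale (\<beta> (a * a')) (l * (b * b') * unit_inv l) =
        scale (\<beta> a) (l * b * unit_inv l) * scale (\<beta> a') (l * b' * unit_inv l)" for a a' b b'
      using \<beta> by (simp add: conj algebra_hom_def scale_mult_left scale_mult_right mult.commute)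
  qed (use \<beta> l in \<open>simp add: algebra_hom_def\<close>)
  have "algebra_hom scale scale (\<lambda>h. lin_ext2 scale (\<lambda>a b. scale ((\<beta> \<circ> S) b) (\<phi> a)) (\<Delta> h))"
  proof (rule algebra_hom_lin_ext2_comult[OF k])
    show "bilinear_map scale scale (\<lambda>a b. scale ((\<beta> \<circ> S) b) (\<phi> a))"
      using \<phi> \<gamma> by (auto simp: bilinear_map_def algebra_hom_def Vector_Spaces.linear_iff
          algebra_simps scale_mult_left scale_mult_right)
  qed (use \<phi> \<gamma> in \<open>auto simp: algebra_hom_def scale_mult_left scale_mult_right mult.commute\<close>)
  also have "(\<lambda>h. lin_ext2 scale (\<lambda>a b. scale ((\<beta> \<circ> S) b) (\<phi> a)) (\<Delta> h)) = mpi_twist l \<beta>"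
    by (simp add: fun_eq_iff mpi_twist_def lin_ext3_comult_left[OF vector_space_axioms] \<phi>_def
        flip: lin_ext2_scale) (simp add: mult.commute)
  finally show ?thesis .
qed

end

section \<open>Characters of H and their values on group-likes\<close>

context presented_hopf_algebra
begin

text \<open>Meaningful when \<open>c ^ p = 1\<close>: existence is then lemma \<open>char\<close>,
  and uniqueness is \<open>char_eqI\<close>.\<close>

definition char :: "'k \<Rightarrow> 'h \<Rightarrow> 'k" where
  "char c = (SOME \<chi>. algebra_hom scale (*) \<chi> \<and> \<chi> g = c \<and> \<chi> x = 0 \<and> \<chi> y = 0)"

lemma char:
  assumes "c ^ p = 1"
  shows "algebra_hom scale (*) (char c)" "char c g = c" "char c x = 0" "char c y = 0"
proof -
  have "0 < p" using p by (rule prime_gt_0_nat)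
  then obtain \<chi> where "algebra_hom scale (*) \<chi>" "\<chi> g = c" "\<chi> x = 0" "\<chi> y = 0"
    by (auto intro: algebra_hom_lift[OF k_algebra_field, of c 0 0] simp: assms)
  then have "\<exists>\<chi>. algebra_hom scale (*) \<chi> \<and> \<chi> g = c \<and> \<chi> x = 0 \<and> \<chi> y = 0" by blast
  from someI_ex[OF this] show "algebra_hom scale (*) (char c)" "char c g = c" "char c x = 0" "char c y = 0"
    by (simp_all add: char_def)
qed

lemma char_eqI:
  assumes "algebra_hom scale (*) \<beta>" "c ^ p = 1" "\<beta> g = c" "\<beta> x = 0" "\<beta> y = 0"
  shows "\<beta> = char c"
  by (rule algebra_hom_eqI[OF assms(1) char(1)[OF assms(2)]]) (simp_all add: assms char)

text \<open>Values of \<beta> commute, so \<open>g * x = scale q (x * g)\<close> becomes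
  \<open>(1 - q) * \<beta> g * \<beta> x = 0\<close>, with \<open>\<beta> g\<close> nonzero because
  its \<open>p\<close>-th power is 1. The same argument with \<open>r\<close> treats
  \<open>y\<close>.\<close>

lemma character_values:
  assumes \<beta>: "algebra_hom scale (*) \<beta>"
  shows "\<beta> g ^ p = 1" "\<beta> x = 0" "\<beta> y = 0"
proof -
  show g: "\<beta> g ^ p = 1"
    using relations(3) algebra_hom_power[OF \<beta>, of g p] \<beta> by (simp add: algebra_hom_def)
  then have "\<beta> g \<noteq> 0" using prime_gt_0_nat[OF p] by (auto simp: power_0_left)
  moreover have "\<beta> (g * x) = q * (\<beta> x * \<beta> g)" "\<beta> (g * y) = r * (\<beta> y * \<beta> g)"
    unfolding relations using \<beta> by (simp_all add: algebra_hom_def Vector_Spaces.linear_iff)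
  then have "\<beta> g * \<beta> x = q * (\<beta> x * \<beta> g)" "\<beta> g * \<beta> y = r * (\<beta> y * \<beta> g)"
    using \<beta> by (simp_all only: algebra_hom_def)
  ultimately show "\<beta> x = 0" "\<beta> y = 0" using q_neq_one r_neq_one by auto
qed

lemma counit_eq_char_one: "\<epsilon> = char 1"
  using counit_character
  by (intro char_eqI) (simp_all add: algebra_character_iff_hom character_values
      group_like_g[unfolded group_like_def])

text \<open>The convolution of \<open>char c\<close> and \<open>char d\<close> is a character with
  value \<open>c * d\<close> at \<open>g\<close>, hence is \<open>char (c * d)\<close>. At
  \<open>l\<close> it splits as a product because the coproduct of \<open>l\<close> is
  \<open>l \<otimes> l\<close>.\<close>

lemma char_mult_group_like:
  assumes l: "group_like scale \<Delta> \<epsilon> l" and c: "c ^ p = 1" and d: "d ^ p = 1"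
  shows "char (c * d) l = char c l * char d l"
proof -
  have bil: "bilinear_map scale (*) (\<lambda>a b. char c a * char d b)"
    using char(1)[OF c] char(1)[OF d]
    by (auto simp: bilinear_map_def algebra_hom_def Vector_Spaces.linear_iff algebra_simps)
  note eq = lin_ext2_tensor_eq2[OF bil]
  have vs: "vector_space ((*) :: 'k \<Rightarrow> 'k \<Rightarrow> 'k)" by (rule k_algebra.axioms(1)[OF k_algebra_field])
  have "(\<lambda>h. lin_ext2 (*) (\<lambda>a b. char c a * char d b) (\<Delta> h)) = char (c * d)"
  proof (rule char_eqI)
    show "algebra_hom scale (*) (\<lambda>h. lin_ext2 (*) (\<lambda>a b. char c a * char d b) (\<Delta> h))"
      using char(1)[OF c] char(1)[OF d]
      by (intro algebra_hom_lin_ext2_comult[OF k_algebra_field bil]) (auto simp: algebra_hom_def)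
  qed (simp_all add: power_mult_distrib eq[OF comult_g] eq[OF comult_x] eq[OF comult_y]
      lin_ext_pure[OF vs] lin_ext_add[OF vs] char c d)
  from fun_cong[OF this, of l] eq[of "\<Delta> l" "pure (l, l)"] l show ?thesis
    by (simp add: group_like_def lin_ext_pure[OF vs])
qed

lemma char_power_group_like:
  assumes l: "group_like scale \<Delta> \<epsilon> l" and c: "c ^ p = 1"
  shows "char (c ^ n) l = char c l ^ n"
proof (induction n)
  case 0
  \<comment> \<open>Here \<open>char 1\<close> is the counit, whose value at a group-like is
    1.\<close>
  then show ?case using l by (simp add: counit_eq_char_one[symmetric] group_like_def)
next
  case (Suc n)
  have "(c ^ n) ^ p = 1" by (metis c power_mult mult.commute power_one)
  then show ?case by (simp add: char_mult_group_like[OF l c] Suc)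
qed

text \<open>With \<open>g\<close> acting as the diagonal matrix with entries \<open>c\<close> and 1,
  conjugation by \<open>g\<close> multiplies an upper entry by \<open>c\<close>; a nonzero entry for
  \<open>x\<close> therefore needs \<open>c = q\<close>, one for \<open>y\<close> needs
  \<open>c = r\<close>. Products of strictly upper triangular matrices vanish, which gives the
  remaining relations on \<open>x\<close> and \<open>y\<close>.\<close>

lemma upper_triangular_representation:
  assumes c: "c ^ p = 1" and "a = 0 \<or> c = q" "b = 0 \<or> c = r" "a = 0 \<or> b = 0"
  obtains \<rho> where "algebra_hom scale utri_scale \<rho>" "\<rho> x = UTri 0 a 0" "\<rho> y = UTri 0 b 0"
    "\<And>h. diag1 (\<rho> h) = char c h" "\<And>h. diag2 (\<rho> h) = \<epsilon> h"
proof -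
  have "2 \<le> p" using p by (rule prime_ge_2_nat)
  obtain \<rho> where \<rho>: "algebra_hom scale utri_scale \<rho>"
    and gen: "\<rho> g = UTri c 0 1" "\<rho> x = UTri 0 a 0" "\<rho> y = UTri 0 b 0"
    by (rule algebra_hom_lift[OF k_algebra_utri, of "UTri c 0 1" "UTri 0 a 0" "UTri 0 b 0"])
      (use assms \<open>2 \<le> p\<close> in \<open>auto simp: UTri_diagonal_power UTri_upper_power, auto simp: utri_simps\<close>)
  note hom = algebra_hom_diag[THEN algebra_hom_comp[OF \<rho>]]
  have "(\<lambda>h. diag1 (\<rho> h)) = char c" "(\<lambda>h. diag2 (\<rho> h)) = \<epsilon>"
    unfolding counit_eq_char_one by (rule char_eqI; use hom gen c in simp)+
  then show ?thesis using that \<rho> gen by (metis (mono_tags))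
qed

text \<open>
  When \<open>\<rho> z\<close> is the matrix unit \<open>E\<^sub>1\<^sub>2\<close>, the only entry of \<open>\<rho> (l z) = m \<rho> (z l)\<close> compares the
  diagonal entries of \<open>\<rho> l\<close>; no basis of \<open>H\<close> and no list of its group-likes is needed.
\<close>

lemma diag1_eq_commutation_factor:
  assumes \<rho>: "algebra_hom scale utri_scale \<rho>" and z: "\<rho> z = UTri 0 1 0"
    and "l * z = scale m (z * l)"
  shows "diag1 (\<rho> l) = m * diag2 (\<rho> l)"
proof -
  have "\<rho> (l * z) = \<rho> (scale m (z * l))" using assms by simp
  then have "\<rho> l * \<rho> z = utri_scale m (\<rho> z * \<rho> l)"
    using \<rho> by (simp add: algebra_hom_def Vector_Spaces.linear_iff)
  then show ?thesis by (simp add: z utri_simps)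
qed

lemma char_q_eq_commutation_factor:
  assumes "l * x = scale m (x * l)" "\<epsilon> l = 1" shows "char q l = m"
proof -
  obtain \<rho> where \<rho>: "algebra_hom scale utri_scale \<rho>" "\<rho> x = UTri 0 1 0"
    and diag: "\<And>h. diag1 (\<rho> h) = char q h" "\<And>h. diag2 (\<rho> h) = \<epsilon> h"
    by (rule upper_triangular_representation[OF q_power_p, of 1 0]) simp_all
  show ?thesis
    using diag1_eq_commutation_factor[OF \<rho> assms(1)] by (simp add: diag assms(2))
qed

lemma char_r_eq_commutation_factor:
  assumes "l * y = scale m (y * l)" "\<epsilon> l = 1" shows "char r l = m"
proof -
  obtain \<rho> where \<rho>: "algebra_hom scale utri_scale \<rho>" "\<rho> y = UTri 0 1 0"
    and diag: "\<And>h. diag1 (\<rho> h) = char r h" "\<And>h. diag2 (\<rho> h) = \<epsilon> h"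
    by (rule upper_triangular_representation[OF r_power_p, of 0 1]) simp_all
  show ?thesis
    using diag1_eq_commutation_factor[OF \<rho> assms(1)] by (simp add: diag assms(2))
qed

text \<open>\<open>S\<close> reverses products, but values of \<beta> commute, so
  \<open>\<beta> \<circ> S\<close> is again a character and \<open>character_values\<close> applies
  to it.\<close>

lemma character_antipode:
  assumes \<beta>: "algebra_hom scale (*) \<beta>"
  shows "algebra_hom scale (*) (\<beta> \<circ> S)" "\<beta> (S g) * \<beta> g = 1" "\<beta> (S x) = 0" "\<beta> (S y) = 0"
proof -
  show "algebra_hom scale (*) (\<beta> \<circ> S)"
    using \<beta> antipode_linear by (auto simp: algebra_hom_def Vector_Spaces.linear_iff antipode_one antipode_mult)
  from character_values[OF this] show "\<beta> (S x) = 0" "\<beta> (S y) = 0" by simp_all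
  have "\<beta> (S g * g) = 1" using \<beta> by (simp add: antipode_generator g_inverse algebra_hom_def)
  then show "\<beta> (S g) * \<beta> g = 1" using \<beta> by (simp add: algebra_hom_def)
qed

lemma unit_inv_group_like:
  assumes "group_like scale \<Delta> \<epsilon> l"
  shows "unit_inv l * l = 1" "l * unit_inv l = 1"
  using antipode_group_like[OF assms] unit_inv_eq[of l "S l"] by simp_all

lemma mpi_twist_generator:
  assumes \<beta>: "algebra_hom scale (*) \<beta>" and l: "group_like scale \<Delta> \<epsilon> l"
  shows "mpi_twist l \<beta> g = l * g * unit_inv l"
    and "mpi_twist l \<beta> x = scale (\<beta> (S g)) (l * x * unit_inv l)"
    and "mpi_twist l \<beta> y = scale (\<beta> (S g) ^ s) (l * y * unit_inv l)"
proof -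
  note \<beta>S = character_antipode[OF \<beta>] and l' = unit_inv_group_like[OF l]
  show "mpi_twist l \<beta> g = l * g * unit_inv l"
    using mpi_twist_group_like[OF \<beta> comult_g] \<beta>S(2) by (simp add: mult.commute)
  show "mpi_twist l \<beta> x = scale (\<beta> (S g)) (l * x * unit_inv l)"
    using mpi_twist_skew_primitive[OF \<beta> comult_x _ _ l'] \<beta>S character_values[OF \<beta>] by simp
  show "mpi_twist l \<beta> y = scale (\<beta> (S g) ^ s) (l * y * unit_inv l)"
    using mpi_twist_skew_primitive[OF \<beta> comult_y _ _ l'] \<beta>S character_values[OF \<beta>]
    by (simp add: antipode_power algebra_hom_power[OF \<beta>])
qed

section \<open>Necessity: congruences forced by a modular pair in involution\<close>

lemma modular_pair_imp:
  assumes "modular_pair_in_involution scale \<Delta> \<epsilon> S l \<beta>"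
  shows "s = 1 \<or> s = p - 1"
proof -
  have l: "group_like scale \<Delta> \<epsilon> l" and \<beta>: "algebra_hom scale (*) \<beta>" and "\<beta> l = 1"
    and twist: "\<And>h. S (S h) = mpi_twist l \<beta> h"
    using assms by (auto simp: modular_pair_in_involution_iff)
  note l' = unit_inv_group_like[OF l]
  define \<zeta> where "\<zeta> = \<beta> g"
  have \<zeta>p: "\<zeta> ^ p = 1" unfolding \<zeta>_def using \<beta> by (rule character_values)
  have char_\<zeta>: "char \<zeta> l = 1"
    using char_eqI[OF \<beta> \<zeta>p] character_values[OF \<beta>] \<open>\<beta> l = 1\<close> by (simp add: \<zeta>_def)
  have inv: "\<beta> (S g) * \<zeta> = 1" unfolding \<zeta>_def using \<beta> by (rule character_antipode)
  have el: "\<epsilon> l = 1" using l by (simp add: group_like_def)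
  \<comment> \<open>Here \<open>a\<close> is the eigenvalue of the squared antipode on
    \<open>z\<close>, \<open>b\<close> is the factor \<beta> contributes to the twist, and
    \<open>m\<close> is the inverse of \<open>b\<close>.\<close>
  have commute: "l * z = scale (a * m) (z * l)"
    if "scale a z = scale b (l * z * unit_inv l)" and "b * m = 1" for a b m z
  proof -
    have "scale (a * m) z = l * z * unit_inv l"
      using arg_cong[OF that(1), of "scale m"] that(2) by (simp add: mult.commute)
    then have "scale (a * m) z * l = l * z * (unit_inv l * l)" by (simp add: mult.assoc)
    then show ?thesis by (simp add: l' scale_mult_left)
  qed
  have "char q l = q * \<zeta>"
    using twist[of x] inv
    by (intro char_q_eq_commutation_factor[OF commute el])
      (simp_all add: antipode_square_generator mpi_twist_generator[OF \<beta> l])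
  moreover have "char r l = r ^ s * \<zeta> ^ s"
    using twist[of y] inv
    by (intro char_r_eq_commutation_factor[OF commute[where b = "\<beta> (S g) ^ s"] el])
      (simp_all add: antipode_square_generator mpi_twist_generator[OF \<beta> l] flip: power_mult_distrib)
  moreover have "char (r * q ^ s) l = char r l * char q l ^ s"
    by (metis char_mult_group_like[OF l r_power_p] char_power_group_like[OF l q_power_p]
        power_mult mult.commute power_one q_power_p)
  moreover have "r * q ^ s = 1" using q_nonzero by (simp flip: power_mult_distrib)
  \<comment> \<open>Exponent 0 in \<open>char_power_group_like\<close> supplies
    \<open>char 1 l = 1\<close>, the value of the multiplicative map at
    \<open>r * q ^ s\<close>.\<close>
  ultimately have y_eq: "r ^ s * \<zeta> ^ s * (q * \<zeta>) ^ s = 1"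
    using char_power_group_like[OF l q_power_p, of 0] by simp
  obtain j where j: "\<zeta> = q ^ j" using root_of_unity_is_power[OF q \<zeta>p] .
  \<comment> \<open>The value at \<zeta> is computed a second time, as the \<open>j\<close>-th power
    of \<open>char q l = q ^ Suc j\<close>.\<close>
  have "q ^ (Suc j * j) = char \<zeta> l"
    unfolding j char_power_group_like[OF l q_power_p] \<open>char q l = q * \<zeta>\<close> power_mult by simp
  then have "p dvd Suc j * j" using char_\<zeta> primitive_root_power_eq_one[OF q] by simp
  then have "p dvd Suc j \<or> p dvd j" using p prime_dvd_mult_iff by blast
  \<comment> \<open>Multiplying \<open>y_eq\<close> by \<open>q ^ (s * s)\<close> cancels
    \<open>r ^ s\<close> and leaves only powers of \<open>q\<close> with natural exponents.\<close>
  have "q ^ (s * j + s * j + s) = q ^ (s * s)"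
  proof -
    have "(q ^ j) ^ s = q ^ (s * j)" by (simp add: mult.commute flip: power_mult)
    have "q ^ (s * s) * (r ^ s * \<zeta> ^ s * (q * \<zeta>) ^ s) = (q ^ (s * s) * r ^ s) * (\<zeta> ^ s * (q * \<zeta>) ^ s)"
      by (simp only: mult.assoc)
    also have "q ^ (s * s) * r ^ s = 1"
      using q_nonzero by (simp flip: power_mult power_mult_distrib)
    also have "\<zeta> ^ s * (q * \<zeta>) ^ s = q ^ (s * j + s * j + s)"
      unfolding j power_mult_distrib power_add \<open>(q ^ j) ^ s = q ^ (s * j)\<close>
      by (simp only: mult.assoc mult.commute mult.left_commute)
    finally show ?thesis by (simp add: y_eq)
  qed
  have "int p dvd int (s * j + s * j + s) - int (s * s)"
    using \<open>q ^ (s * j + s * j + s) = q ^ (s * s)\<close> by (rule primitive_root_power_eq[OF q])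
  also have "int (s * j + s * j + s) - int (s * s) = int s * (2 * int j + 1 - int s)"
    by (simp add: algebra_simps)
  finally have "int p dvd int s * (2 * int j + 1 - int s)" .
  \<comment> \<open>Since \<open>0 < s < p\<close>, the factor \<open>s\<close> cancels modulo
    \<open>p\<close>, leaving s congruent to 2 j + 1.\<close>
  moreover have "\<not> int p dvd int s" using s by (auto dest: dvd_imp_le)
  ultimately have *: "int p dvd 2 * int j + 1 - int s"
    using p by (simp add: prime_dvd_mult_iff)
  have cases: "int p dvd int j + 1 \<or> int p dvd int j"
    using \<open>p dvd Suc j \<or> p dvd j\<close> by (simp flip: int_dvd_int_iff add: add.commute)
  \<comment> \<open>For j congruent to -1 this makes s congruent to -1; for j congruent to 0 it
    makes s congruent to 1.\<close>
  have "int p dvd int s - 1 \<or> int p dvd int s + 1"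
    using cases
  proof
    assume "int p dvd int j + 1"
    from dvd_diff[OF dvd_mult[OF this, of 2] *] show ?thesis by (simp add: add.commute)
  next
    assume "int p dvd int j"
    from dvd_diff[OF dvd_mult[OF this, of 2] *] show ?thesis by simp
  qed
  moreover have "s < p" "0 < s" using s by auto
  ultimately show ?thesis
    using zdvd_imp_le[of "int p" "int s - 1"] zdvd_imp_le[of "int p" "int s + 1"] by fastforce
qed

section \<open>Sufficiency: construction of modular pairs in involution\<close>

lemma modular_pairI:
  assumes l: "group_like scale \<Delta> \<epsilon> l" and c: "c * d = 1" "d ^ p = 1" "char d l = 1"
    and "l * g = g * l" and "l * x * unit_inv l = scale (q * d) x"
    and "l * y * unit_inv l = scale (r ^ s * d ^ s) y"
  shows "modular_pair_in_involution scale \<Delta> \<epsilon> S l (char d)"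
proof -
  let ?\<beta> = "char d"
  have \<beta>: "algebra_hom scale (*) ?\<beta>" using c(2) by (rule char)
  note l' = unit_inv_group_like[OF l]
  have "?\<beta> (S g) * d = 1"
    using character_antipode(2)[OF \<beta>] by (simp add: char c)
  \<comment> \<open>Both \<open>c\<close> and the value of the character at \<open>S g\<close> are
    inverse to \<open>d\<close>.\<close>
  then have Sg: "?\<beta> (S g) = c" using c(1) by (metis mult.commute mult.left_commute mult_1_right)
  have "c ^ s * d ^ s = 1" using c(1) by (simp flip: power_mult_distrib)
  \<comment> \<open>Both sides are algebra homomorphisms, so agreement on the three generators
    suffices.\<close>
  then have "(\<lambda>h. S (S h)) = mpi_twist l ?\<beta>"
    using assms l' c(1)
    by (intro algebra_hom_eqI[OF algebra_hom_antipode_square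
          algebra_hom_mpi_twist[OF \<beta> character_antipode(1)[OF \<beta>] l']])
      (simp_all add: antipode_square_generator mpi_twist_generator[OF \<beta> l] Sg mult.assoc mult.left_commute)
  then show ?thesis
    using l \<beta> c(3) by (simp add: modular_pair_in_involution_iff fun_eq_iff)
qed

text \<open>For \<open>s = 1\<close> conjugation by \<open>g\<close> scales \<open>x\<close> by
  \<open>q\<close> and \<open>y\<close> by \<open>r\<close>, exactly as the squared antipode does,
  so the trivial character works. For \<open>s = p - 1\<close> with \<open>l = 1\<close>, the
  condition at \<open>x\<close> forces the character value \<open>inverse q\<close> at
  \<open>g\<close>; the condition at \<open>y\<close> then holds because \<open>s * s + s\<close> is
  a multiple of \<open>p\<close>.\<close>

lemma modular_pair_exists:
  assumes "s = 1 \<or> s = p - 1"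
  shows "\<exists>l \<beta>. modular_pair_in_involution scale \<Delta> \<epsilon> S l \<beta>"
proof -
  have unit_inv: "unit_inv g = g'" "unit_inv (1 :: 'h) = 1"
    using g_inverse by (auto intro: unit_inv_eq)
  from assms show ?thesis
  proof
    assume "s = 1"
    then have "modular_pair_in_involution scale \<Delta> \<epsilon> S g (char 1)"
      using conj_g_power_y[of 1]
      by (intro modular_pairI[where c = 1] group_like_g) (simp_all add: char unit_inv conj_g_x)
    then show ?thesis by blast
  next
    assume "s = p - 1"
    then have "p = Suc s" using s by auto
    then have "s * s + s = p * s" by simp
    have "r ^ s * inverse q ^ s = inverse q ^ (s * s + s)" by (simp only: power_add power_mult)
    also have "\<dots> = (inverse q ^ p) ^ s" by (simp only: \<open>s * s + s = p * s\<close> power_mult)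
    finally have "r ^ s * inverse q ^ s = (inverse q ^ p) ^ s" .
    moreover have d: "inverse q ^ p = 1" by (simp add: power_inverse q_power_p)
    moreover have "char (inverse q) 1 = 1" using char(1)[OF d] by (simp add: algebra_hom_def)
    ultimately have "modular_pair_in_involution scale \<Delta> \<epsilon> S 1 (char (inverse q))"
      using q_nonzero
      by (intro modular_pairI[where c = q] group_like_one) (simp_all add: unit_inv q_power_p)
    then show ?thesis by blast
  qed
qed

end

theorem mainTheorem1:
  fixes scale :: "'k::field \<Rightarrow> 'h::ring_1 \<Rightarrow> 'h"
    and \<Delta> :: "'h \<Rightarrow> ('h \<times> 'h \<Rightarrow>\<^sub>0 'k)" and \<epsilon> :: "'h \<Rightarrow> 'k" and S :: "'h \<Rightarrow> 'h"
    and g x y :: 'h and p s :: nat and q :: 'k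
  assumes "prime p"
    and "s \<in> {0..<p} - {0}"
    and "primitive_root_of_unity p q"
    and "hopf_algebra scale \<Delta> \<epsilon> S"
    and "presented_by scale (case_generator g x y) (hopf_relations p s q)"
    and "tensor_eq2 scale (\<Delta> g) (pure (g, g))"
    and "tensor_eq2 scale (\<Delta> x) (pure (1, x) + pure (x, g))"
    and "tensor_eq2 scale (\<Delta> y) (pure (1, y) + pure (y, g ^ s))"
  shows "(\<forall>T. algebra_antihom scale T \<and>
              T g = unit_inv g \<and> T x = - (x * unit_inv g) \<and> T y = - (y * unit_inv g ^ s)
            \<longleftrightarrow> T = S)
       \<and> ((\<exists>l \<beta>. modular_pair_in_involution scale \<Delta> \<epsilon> S l \<beta>) \<longleftrightarrow> s \<in> {0, 1, p - 1})"
proof -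
  interpret H: presented_hopf_algebra scale \<Delta> \<epsilon> S g x y p s q
    using assms by (simp add: presented_hopf_algebra_def presented_hopf_algebra_axioms_def)
  have unit_inv: "unit_inv g = H.g'" using H.g_inverse by (rule unit_inv_eq)
  \<comment> \<open>The antipode has these properties, and an antihomomorphism is determined by its
    values on the generators.\<close>
  have "algebra_antihom scale T \<and>
      T g = unit_inv g \<and> T x = - (x * unit_inv g) \<and> T y = - (y * unit_inv g ^ s) \<longleftrightarrow> T = S" for T
    unfolding unit_inv using H.algebra_antihom_antipode H.antipode_generator
    by (auto intro!: H.algebra_antihom_eqI)
  moreover have "(\<exists>l \<beta>. modular_pair_in_involution scale \<Delta> \<epsilon> S l \<beta>) \<longleftrightarrow> s \<in> {0, 1, p - 1}"
    using H.modular_pair_imp H.modular_pair_exists assms(2) by auto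
  ultimately show ?thesis by blast
qed

end
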